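(* Let $(u_1,v_1,u_2,v_2)$ be an orthonormal basis of $\mathbb{R}^4$ and let $r_1,r_2>0$, $\phi_1>\phi_2>0$. For $k=1,2$ define $a_k=r_k(u_k\sin\phi_k+v_k\cos\phi_k)$ and $b_k=r_k(v_k\sin\phi_k-u_k\cos\phi_k)$, and let $\gamma(\cdot,a,b,\phi)$ be the corresponding extremal. Then the point $$\gamma(1,a,b,\phi)=\big(r_1T_1v_1+r_2T_2v_2,\ r_1^2U_1\,u_1\wedge v_1+r_1r_2Z_{12}\,u_1\wedge v_2+r_1r_2Z_{21}\,u_2\wedge v_1+r_2^2U_2\,u_2\wedge v_2\big)$$ is conjugate to $(0,0)$ along $s\mapsto\gamma(s,a,b,\phi)$ if and only if at least one of the following two square matrices is singular: $$M_1=\begin{bmatrix}-T_1&0&-r_2^2T_2&0\\ 0&-T_2&0&-r_1^2T_1\\ Z_{21}&-Z_{12}&r_2^2U_2&-r_1^2U_1\\ Z_{12}&-Z_{21}&-r_1^2U_1&r_2^2U_2\end{bmatrix}$$ or $$M_2=\begin{bmatrix}0&-r_2^2T_2&T_1&0&-2V_1&0\\ 0&r_1^2T_1&0&T_2&0&-2V_2\\ -r_2^2Z_{21}&-r_2^2Z_{12}&2U_1&0&\frac{\cos\phi_1}{\phi_1}V_1&0\\ -r_2^2U_2&r_1^2U_1&Z_{12}&Z_{12}&(\partial_1Z)(\phi_1,\phi_2)&(\partial_2Z)(\phi_1,\phi_2)\\ -r_1^2U_1&r_2^2U_2&-Z_{21}&-Z_{21}&-(\partial_2Z)(\phi_2,\phi_1)&-(\partial_1Z)(\phi_2,\phi_1)\\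 r_1^2Z_{12}&r_1^2Z_{21}&0&2U_2&0&\frac{\cos\phi_2}{\phi_2}V_2\end{bmatrix}.$$
   Context: Functions: $$T(\phi)=\frac{\sin\phi}{\phi},\quad U(\phi)=\frac{\phi-\sin\phi\cos\phi}{4\phi^2},\quad V(\phi)=\frac{\sin\phi-\phi\cos\phi}{2\phi^2}\quad(\phi>0),$$ $$Z(x,y)=\frac{y\cos y\sin x-x\cos x\sin y}{2y(x^2-y^2)}\quad(x,y>0,\ x\neq y).$$ Abbreviations: $T_k=T(\phi_k)$, $U_k=U(\phi_k)$, $V_k=V(\phi_k)$, $Z_{jk}=Z(\phi_j,\phi_k)$; $\partial_1Z,\partial_2Z$ are the partial derivatives with respect to the first and second argument. Given a control $u:\mathbb{R}\to\mathbb{R}^4$, the associated curve $(x,t)$ in $\mathbb{R}^4\times\Lambda^2\mathbb{R}^4$ is the solution of $\dot x=u$, $\dot t=\frac12x\wedge u$, $(x(0),t(0))=(0,0)$. The extremal $\gamma(\cdot,a,b,\phi)$ is the curve associated with $u(s)=a_1\cos(2\phi_1s)+b_1\sin(2\phi_1s)+a_2\cos(2\phi_2s)+b_2\sin(2\phi_2s)$. Identify $\Lambda^2\mathbb{R}^4$ with $\mathfrak{so}(4)$ by extending linearly $u\wedge v\simeq uv^T-vu^T$. The sub-Riemannian exponential $\exp:\mathbb{R}^4\times\mathfrak{so}(4)\to\mathbb{R}^4\times\Lambda^2\mathbb{R}^4$ sends $(\xi,\tau)$ to the point at time $1$ of the curve associated with the control $s\mapsto e^{-s\tau}\xi$. If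 $\gamma$ is the curve associated with the control $e^{-s\tau}\xi$, the point $\gamma(1)=\exp(\xi,\tau)$ is called conjugate to $(0,0)$ along $\gamma$ if the differential $d_{(\xi,\tau)}\exp$ is singular. The extremal $\gamma(\cdot,a,b,\phi)$ in the statement corresponds to the covector $\xi=a_1+a_2$, $\tau=\frac{2\phi_1}{r_1^2}a_1\wedge b_1+\frac{2\phi_2}{r_2^2}a_2\wedge b_2$, i.e. its control is $e^{-s\tau}\xi$. *)

theory Defs
  imports "HOL-Analysis.Analysis"
begin

section \<open>The functions \<open>T\<close>, \<open>U\<close>, \<open>V\<close>, \<open>Z\<close>\<close>

definition T :: "real \<Rightarrow> real" where
  "T \<phi> = sin \<phi> / \<phi>"

definition U :: "real \<Rightarrow> real" where
  "U \<phi> = (\<phi> - sin \<phi> * cos \<phi>) / (4 * \<phi>\<^sup>2)"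

definition V :: "real \<Rightarrow> real" where
  "V \<phi> = (sin \<phi> - \<phi> * cos \<phi>) / (2 * \<phi>\<^sup>2)"

definition Z :: "real \<Rightarrow> real \<Rightarrow> real" where
  "Z x y = (y * cos y * sin x - x * cos x * sin y) / (2 * y * (x\<^sup>2 - y\<^sup>2))"

definition partial1 :: "(real \<Rightarrow> real \<Rightarrow> real) \<Rightarrow> real \<Rightarrow> real \<Rightarrow> real" where
  "partial1 f x y = deriv (\<lambda>s. f s y) x"

definition partial2 :: "(real \<Rightarrow> real \<Rightarrow> real) \<Rightarrow> real \<Rightarrow> real \<Rightarrow> real" where
  "partial2 f x y = deriv (\<lambda>s. f x s) y"


section \<open>Orthonormal bases and the identification of bivectors with skew matrices\<close>

definition orthonormal_basis :: "'a::euclidean_space list \<Rightarrow> bool" where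
  "orthonormal_basis vs \<longleftrightarrow>
     distinct vs \<and> pairwise orthogonal (set vs) \<and> (\<forall>v\<in>set vs. norm v = 1) \<and> span (set vs) = UNIV"

definition so4 :: "(real^4^4) set" where
  "so4 = {A. transpose A = - A}"

text \<open>The second exterior power of \<open>\<real>\<^sup>4\<close> is represented by \<^const>\<open>so4\<close>,
  with \<open>u \<and> v\<close> identified with \<open>u v\<^sup>T - v u\<^sup>T\<close>.\<close>

definition wedge :: "real^4 \<Rightarrow> real^4 \<Rightarrow> real^4^4" where
  "wedge u v = (\<chi> i j. u $ i * v $ j - v $ i * u $ j)"


section \<open>Curves associated with a control\<close>

type_synonym point = "(real^4) \<times> (real^4^4)"

definition is_curve :: "(real \<Rightarrow> real^4) \<Rightarrow> (real \<Rightarrow> point) \<Rightarrow> bool" where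
  "is_curve u \<gamma> \<longleftrightarrow>
     \<gamma> 0 = (0, 0) \<and>
     (\<forall>s. (\<gamma> has_vector_derivative (u s, (1/2) *\<^sub>R wedge (fst (\<gamma> s)) (u s))) (at s))"

text \<open>For a continuous control the associated curve exists and is unique;
  see \<open>ex1_is_curve\<close> below. All controls considered here are continuous.\<close>

definition curve :: "(real \<Rightarrow> real^4) \<Rightarrow> real \<Rightarrow> point" where
  "curve u = (THE \<gamma>. is_curve u \<gamma>)"

lemma bounded_bilinear_wedge: "bounded_bilinear wedge"
proof -
  have "bilinear wedge"
    unfolding bilinear_def wedge_def
    by (auto intro!: linearI simp: vec_eq_iff algebra_simps)
  then show ?thesis
    by (simp add: bilinear_conv_bounded_bilinear)
qed

lemma has_vector_derivative_unique_from_0: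
  fixes f g :: "real \<Rightarrow> 'a::real_normed_vector"
  assumes "\<And>s. (f has_vector_derivative h s) (at s)"
    and "\<And>s. (g has_vector_derivative h s) (at s)" and "f 0 = g 0"
  shows "f = g"
proof
  fix s
  have "((\<lambda>s. f s - g s) has_vector_derivative 0) (at s)" for s
    using has_vector_derivative_diff[OF assms(1,2)] by simp
  then have "(\<lambda>s. f s - g s) s = (\<lambda>s. f s - g s) 0"
    by (intro has_derivative_zero_unique[of UNIV "\<lambda>s. f s - g s"])
       (auto simp: has_vector_derivative_def)
  then show "f s = g s"
    using assms(3) by simp
qed

lemma antiderivative_from_0:
  fixes h :: "real \<Rightarrow> 'a::euclidean_space"
  assumes "continuous_on UNIV h"
  obtains F where "F 0 = 0" "\<And>s. (F has_vector_derivative h s) (at s)"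
proof -
  have "\<exists>F. \<forall>x. (-\<infinity>::ereal) < ereal x \<longrightarrow> ereal x < \<infinity> \<longrightarrow> (F has_vector_derivative h x) (at x)"
    using assms by (intro einterval_antiderivative)
      (auto simp: continuous_on_eq_continuous_at)
  then obtain F where F: "\<And>x. (F has_vector_derivative h x) (at x)"
    by auto
  show thesis
  proof (rule that[of "\<lambda>s. F s - F 0"])
    fix s show "((\<lambda>s. F s - F 0) has_vector_derivative h s) (at s)"
      using has_vector_derivative_diff[OF F has_vector_derivative_const] by simp
  qed simp
qed

lemma ex1_is_curve:
  assumes u: "continuous_on UNIV u"
  shows "\<exists>!\<gamma>. is_curve u \<gamma>"
proof -
  obtain X where X0: "X 0 = 0" and X: "\<And>s. (X has_vector_derivative u s) (at s)"
    using antiderivative_from_0[OF u] by blast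
  have contX: "continuous_on UNIV X"
    using X has_vector_derivative_continuous continuous_at_imp_continuous_on by blast
  define w where "w s = (1/2) *\<^sub>R wedge (X s) (u s)" for s
  have "continuous_on UNIV w"
    unfolding w_def
    by (intro continuous_intros bounded_bilinear.continuous_on[OF bounded_bilinear_wedge] contX u)
  then obtain Y where Y0: "Y 0 = 0" and Y: "\<And>s. (Y has_vector_derivative w s) (at s)"
    using antiderivative_from_0 by blast
  show ?thesis
  proof (rule ex1I)
    show "is_curve u (\<lambda>s. (X s, Y s))"
      unfolding is_curve_def using X Y
      by (auto simp: X0 Y0 w_def intro!: has_vector_derivative_Pair)
  next
    fix \<gamma> assume \<gamma>: "is_curve u \<gamma>"
    have D: "(\<gamma> has_vector_derivative (u s, (1/2) *\<^sub>R wedge (fst (\<gamma> s)) (u s))) (at s)" for s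
      using \<gamma> by (auto simp: is_curve_def)
    have "fst \<circ> \<gamma> = X"
    proof (rule has_vector_derivative_unique_from_0[OF _ X])
      show "(fst \<circ> \<gamma> has_vector_derivative u s) (at s)" for s
        using bounded_linear.has_vector_derivative[OF bounded_linear_fst D] by (simp add: o_def)
      show "(fst \<circ> \<gamma>) 0 = X 0"
        using \<gamma> by (simp add: is_curve_def X0)
    qed
    then have fst: "fst (\<gamma> s) = X s" for s
      by (auto simp: fun_eq_iff)
    have "snd \<circ> \<gamma> = Y"
    proof (rule has_vector_derivative_unique_from_0[OF _ Y])
      show "(snd \<circ> \<gamma> has_vector_derivative w s) (at s)" for s
        using bounded_linear.has_vector_derivative[OF bounded_linear_snd D]
        by (simp add: o_def w_def fst)
      show "(snd \<circ> \<gamma>) 0 = Y 0"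
        using \<gamma> by (simp add: is_curve_def Y0)
    qed
    with fst show "\<gamma> = (\<lambda>s. (X s, Y s))"
      by (auto simp: fun_eq_iff prod_eq_iff)
  qed
qed

lemma is_curve_curve: "continuous_on UNIV u \<Longrightarrow> is_curve u (curve u)"
  unfolding curve_def by (rule theI'[OF ex1_is_curve])

definition extremal_control ::
    "real^4 \<Rightarrow> real^4 \<Rightarrow> real^4 \<Rightarrow> real^4 \<Rightarrow> real \<Rightarrow> real \<Rightarrow> real \<Rightarrow> real^4" where
  "extremal_control a1 b1 a2 b2 \<phi>1 \<phi>2 s =
     cos (2 * \<phi>1 * s) *\<^sub>R a1 + sin (2 * \<phi>1 * s) *\<^sub>R b1
   + cos (2 * \<phi>2 * s) *\<^sub>R a2 + sin (2 * \<phi>2 * s) *\<^sub>R b2"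

definition extremal ::
    "real^4 \<Rightarrow> real^4 \<Rightarrow> real^4 \<Rightarrow> real^4 \<Rightarrow> real \<Rightarrow> real \<Rightarrow> real \<Rightarrow> point" where
  "extremal a1 b1 a2 b2 \<phi>1 \<phi>2 = curve (extremal_control a1 b1 a2 b2 \<phi>1 \<phi>2)"


section \<open>The sub-Riemannian exponential and conjugate points\<close>

text \<open>Multiplication in the type class sense is componentwise on matrices, so the
  exponential series is written out with powers taken with respect to \<open>**\<close>.\<close>

definition matrix_exp :: "real^'n^'n \<Rightarrow> real^'n^'n" where
  "matrix_exp A = (\<Sum>k. (1 / fact k) *\<^sub>R (((**) A) ^^ k) (mat 1))"

definition covector_control :: "real^4 \<Rightarrow> real^4^4 \<Rightarrow> real \<Rightarrow> real^4" where
  "covector_control \<xi> \<tau> s = matrix_exp ((- s) *\<^sub>R \<tau>) *v \<xi>"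

definition sR_exp :: "(real^4) \<times> (real^4^4) \<Rightarrow> point" where
  "sR_exp = (\<lambda>(\<xi>, \<tau>). curve (covector_control \<xi> \<tau>) 1)"

text \<open>The differential of \<^const>\<open>sR_exp\<close> is an endomorphism of the 10-dimensional space
  \<open>\<real>\<^sup>4 \<times> so(4)\<close>, which is here a proper subspace of the ambient matrix space. The derivative
  is therefore taken within that subspace, where it is uniquely determined, and it is singular
  if it is not bijective there.\<close>

definition sR_exp_singular_at :: "(real^4) \<times> (real^4^4) \<Rightarrow> bool" where
  "sR_exp_singular_at p \<longleftrightarrow>
     (\<exists>D. (sR_exp has_derivative D) (at p within UNIV \<times> so4) \<and>
          \<not> bij_betw D (UNIV \<times> so4) (UNIV \<times> so4))"

text \<open>The point \<open>q\<close> is conjugate to the origin along \<open>\<gamma>\<close>, the curve with covector \<open>(\<xi>, \<tau>)\<close>.\<close>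

definition conjugate_along :: "(real^4) \<times> (real^4^4) \<Rightarrow> (real \<Rightarrow> point) \<Rightarrow> point \<Rightarrow> bool" where
  "conjugate_along = (\<lambda>(\<xi>, \<tau>) \<gamma> q.
     \<tau> \<in> so4 \<and> \<gamma> = curve (covector_control \<xi> \<tau>) \<and> q = \<gamma> 1 \<and> sR_exp_singular_at (\<xi>, \<tau>))"


section \<open>The matrices \<open>M\<^sub>1\<close> and \<open>M\<^sub>2\<close>\<close>

definition M1 :: "real \<Rightarrow> real \<Rightarrow> real \<Rightarrow> real \<Rightarrow> real^4^4" where
  "M1 r1 r2 \<phi>1 \<phi>2 = vector
    [vector [- T \<phi>1, 0, - r2\<^sup>2 * T \<phi>2, 0],
     vector [0, - T \<phi>2, 0, - r1\<^sup>2 * T \<phi>1],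
     vector [Z \<phi>2 \<phi>1, - Z \<phi>1 \<phi>2, r2\<^sup>2 * U \<phi>2, - r1\<^sup>2 * U \<phi>1],
     vector [Z \<phi>1 \<phi>2, - Z \<phi>2 \<phi>1, - r1\<^sup>2 * U \<phi>1, r2\<^sup>2 * U \<phi>2]]"

definition M2 :: "real \<Rightarrow> real \<Rightarrow> real \<Rightarrow> real \<Rightarrow> real^6^6" where
  "M2 r1 r2 \<phi>1 \<phi>2 = vector
    [vector [0, - r2\<^sup>2 * T \<phi>2, T \<phi>1, 0, - 2 * V \<phi>1, 0],
     vector [0, r1\<^sup>2 * T \<phi>1, 0, T \<phi>2, 0, - 2 * V \<phi>2],
     vector [- r2\<^sup>2 * Z \<phi>2 \<phi>1, - r2\<^sup>2 * Z \<phi>1 \<phi>2, 2 * U \<phi>1, 0, cos \<phi>1 / \<phi>1 * V \<phi>1, 0],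
     vector [- r2\<^sup>2 * U \<phi>2, r1\<^sup>2 * U \<phi>1, Z \<phi>1 \<phi>2, Z \<phi>1 \<phi>2,
             partial1 Z \<phi>1 \<phi>2, partial2 Z \<phi>1 \<phi>2],
     vector [- r1\<^sup>2 * U \<phi>1, r2\<^sup>2 * U \<phi>2, - Z \<phi>2 \<phi>1, - Z \<phi>2 \<phi>1,
             - partial2 Z \<phi>2 \<phi>1, - partial1 Z \<phi>2 \<phi>1],
     vector [r1\<^sup>2 * Z \<phi>1 \<phi>2, r1\<^sup>2 * Z \<phi>2 \<phi>1, 0, 2 * U \<phi>2, 0, cos \<phi>2 / \<phi>2 * V \<phi>2]]"

end

theory Submission
  imports Defs
begin

text \<open>
  The controls \<open>e\<^sup>-\<^sup>s\<^sup>\<tau>\<xi>\<close> can be written down explicitly when \<open>\<tau>\<close> is in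
  normal form. If \<open>\<tau> = 2\<phi>\<^sub>1 u\<^sub>1 \<and> v\<^sub>1 + 2\<phi>\<^sub>2 u\<^sub>2 \<and> v\<^sub>2\<close> for an orthonormal frame, then the control
  consists of two uniform rotations, with angles \<open>\<phi>\<^sub>k (1 - 2s)\<close> when \<open>\<xi>\<close> is placed
  suitably in each plane. The curve is then a trigonometric integral, and its endpoint is an explicit
  function of the frame, the radii \<open>r\<^sub>1, r\<^sub>2\<close> and the angles \<open>\<phi>\<^sub>1, \<phi>\<^sub>2\<close>
  (\<open>sR_exp_covector\<close>).

  Frames, radii and angles are ten parameters, as many as the dimension of
  \<open>\<real>\<^sup>4 \<times> so(4)\<close>. If \<open>\<phi>\<^sub>1\<^sup>2 \<noteq> \<phi>\<^sub>2\<^sup>2\<close> and the radii do not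
  vanish, then moving these parameters moves the covector in all directions, without redundancy
  (\<open>bij_betw_covector_coords\<close>). Hence the differential of the exponential is known as soon as it is
  known on those directions. There it is obtained from the chain rule by differentiating the explicit
  endpoint (\<open>derivative_along_variation\<close>). A moving frame is \<open>e\<^sup>s\<^sup>X\<close> applied to the
  original one, with \<open>X\<close> in \<open>so(4)\<close>.

  The matrix of the differential splits because of a parity. Under the reflection
  \<open>u\<^sub>k \<mapsto> - u\<^sub>k\<close> the endpoint has an even component along \<open>v\<^sub>1, v\<^sub>2\<close> and odd components
  along \<open>u\<^sub>j \<and> v\<^sub>k\<close>. The four infinitesimal rotations that mix a \<open>u\<close> with a
  \<open>v\<close> change this parity, so they produce only \<open>u\<^sub>1, u\<^sub>2, u\<^sub>1 \<and> u\<^sub>2, v\<^sub>1 \<and> v\<^sub>2\<close>.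
  The two remaining rotations and the variations of radii and angles preserve it. After rescaling
  rows and columns by powers of \<open>r\<^sub>1, r\<^sub>2\<close> the two blocks are \<open>M\<^sub>1\<close> and \<open>M\<^sub>2\<close>
  (\<open>endpoint_variation_coords\<close>), so the differential is bijective if and only if both are invertible.

  The existence of the differential is a separate matter, since the parametrisation only determines
  its values. It is proved by estimating the solutions of the control equation
  \<open>u' = - \<tau> u\<close> against those of the linearised equation (\<open>sR_exp_differentiable\<close>).
\<close>

section \<open>Linear differential equations and skew matrices\<close>

text \<open>Differentiating the exponential series term by term is a statement about real power series once an
  inner product with a basis vector has been taken.\<close>

lemma linear_ode_series:
  fixes L :: "'a::euclidean_space \<Rightarrow> 'a" and z :: 'a
  assumes "bounded_linear L"
  defines "S \<equiv> \<lambda>s. \<Sum>k. (s ^ k / fact k) *\<^sub>R (L ^^ k) z"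
  shows "S 0 = z" and "(S has_vector_derivative L (S s)) (at s)"
proof -
  interpret L: bounded_linear L by fact
  obtain K where K: "K > 0" "\<And>x. norm (L x) \<le> norm x * K"
    using L.pos_bounded by blast
  have iter: "norm ((L ^^ k) z) \<le> norm z * K ^ k" for k
  proof (induction k)
    case (Suc k)
    have "norm (L ((L ^^ k) z)) \<le> norm ((L ^^ k) z) * K" by (rule K)
    also have "\<dots> \<le> norm z * K ^ k * K" using Suc K by (intro mult_right_mono) auto
    finally show ?case by (simp add: mult_ac)
  qed simp
  have summ: "summable (\<lambda>k. (s ^ k / fact k) *\<^sub>R (L ^^ k) z)" for s
  proof (rule summable_comparison_test')
    show "summable (\<lambda>k. norm z * (inverse (fact k) * (K * \<bar>s\<bar>) ^ k))"
      by (intro summable_mult summable_exp)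
    show "norm ((s ^ k / fact k) *\<^sub>R (L ^^ k) z) \<le> norm z * (inverse (fact k) * (K * \<bar>s\<bar>) ^ k)" for k
      using mult_left_mono[OF iter[of k], of "\<bar>s\<bar> ^ k / fact k"]
      by (simp add: power_abs power_mult_distrib field_simps)
  qed
  show "S 0 = z"
  proof -
    have "(\<lambda>k. (0 ^ k / fact k) *\<^sub>R (L ^^ k) z) sums ((0 ^ 0 / fact 0) *\<^sub>R (L ^^ 0) z)"
      by (rule sums_unique2 sums_finite[of "{0}", simplified]) auto
    then show ?thesis by (simp add: S_def sums_iff)
  qed
  have LS: "L (S s) = (\<Sum>k. (s ^ k / fact k) *\<^sub>R (L ^^ Suc k) z)"
    unfolding S_def using L.suminf[OF summ[of s]] by (simp add: L.scaleR)
  have summ': "summable (\<lambda>k. (s ^ k / fact k) *\<^sub>R (L ^^ Suc k) z)"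
    using L.summable[OF summ[of s]] by (simp add: L.scaleR)
  have "((\<lambda>s. S s \<bullet> b) has_real_derivative L (S s) \<bullet> b) (at s)" for b
  proof -
    define c where "c k = ((L ^^ k) z \<bullet> b) / fact k" for k
    have bl: "bounded_linear (\<lambda>x::'a. x \<bullet> b)" by (rule bounded_linear_inner_left)
    have "summable (\<lambda>k. c k * t ^ k)" for t
      using bounded_linear.summable[OF bl summ[of t]] by (simp add: c_def mult_ac)
    then have "((\<lambda>s. \<Sum>k. c k * s ^ k) has_field_derivative (\<Sum>k. diffs c k * s ^ k)) (at s)"
      by (rule termdiffs_strong_converges_everywhere)
    moreover have "(\<Sum>k. c k * s ^ k) = S s \<bullet> b" for s
      unfolding S_def using bounded_linear.suminf[OF bl summ[of s]] by (simp add: c_def mult_ac)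
    moreover have "diffs c k * s ^ k = ((s ^ k / fact k) *\<^sub>R (L ^^ Suc k) z) \<bullet> b" for k
      by (simp add: diffs_def c_def mult_ac del: of_nat_Suc)
    then have "(\<Sum>k. diffs c k * s ^ k) = L (S s) \<bullet> b"
      unfolding LS using bounded_linear.suminf[OF bl summ'] by simp
    ultimately show ?thesis by simp
  qed
  then show "(S has_vector_derivative L (S s)) (at s)"
    unfolding has_vector_derivative_def
    by (subst has_derivative_componentwise_within)
       (simp add: has_field_derivative_def mult_commute_abs)
qed

lemma wedge_mult_vec: "wedge a b *v c = (b \<bullet> c) *\<^sub>R a - (a \<bullet> c) *\<^sub>R b"
  by (simp add: wedge_def vec_eq_iff matrix_vector_mult_def inner_vec_def sum_4 algebra_simps)

lemma wedge_in_so4 [simp]: "wedge a b \<in> so4"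
  by (simp add: so4_def wedge_def transpose_def vec_eq_iff)

lemma subspace_so4: "subspace so4"
proof -
  have "transpose (A + B) = transpose A + transpose B"
    and "transpose (c *\<^sub>R A) = c *\<^sub>R transpose A"
    and "transpose (0 :: real^4^4) = 0" for A B :: "real^4^4" and c
    by (simp_all add: transpose_def vec_eq_iff)
  then show ?thesis by (simp add: subspace_def so4_def)
qed

lemma bounded_bilinear_matrix_vector_mult:
  "bounded_bilinear ((*v) :: real^'n^'m \<Rightarrow> real^'n \<Rightarrow> real^'m)"
proof -
  have "bilinear ((*v) :: real^'n^'m \<Rightarrow> real^'n \<Rightarrow> real^'m)"
    unfolding bilinear_def
    by (auto intro!: linearI simp: matrix_vector_mult_add_rdistrib matrix_vector_right_distrib
          scaleR_matrix_vector_assoc matrix_vector_mult_scaleR)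
  then show ?thesis by (simp add: bilinear_conv_bounded_bilinear)
qed

interpretation wedge: bounded_bilinear wedge
  by (rule bounded_bilinear_wedge)

interpretation mvec: bounded_bilinear "(*v) :: real^'n^'m \<Rightarrow> real^'n \<Rightarrow> real^'m"
  by (rule bounded_bilinear_matrix_vector_mult)

lemma bounded_linear_matrix_mult:
  "bounded_linear ((**) (A :: real^'n^'n) :: real^'n^'n \<Rightarrow> _)"
  unfolding linear_conv_bounded_linear[symmetric]
  by (rule linearI)
     (simp_all add: matrix_add_ldistrib vec_eq_iff matrix_matrix_mult_def sum_distrib_left algebra_simps sum.distrib)

lemma so4_inner_skew:
  assumes "A \<in> so4" shows "x \<bullet> (A *v y) = - (y \<bullet> (A *v x))"
proof -
  have "x \<bullet> (A *v y) = (transpose A *v x) \<bullet> y"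
    by (simp add: dot_lmul_matrix)
  also have "\<dots> = - (y \<bullet> (A *v x))"
    using assms by (simp add: so4_def inner_commute mvec.minus_left)
  finally show ?thesis .
qed

lemma so4_inner_self: "A \<in> so4 \<Longrightarrow> x \<bullet> (A *v x) = 0"
  using so4_inner_skew[of A x x] by simp

lemma covector_control_ode:
  "covector_control \<xi> \<tau> 0 = \<xi>"
  "(covector_control \<xi> \<tau> has_vector_derivative - (\<tau> *v covector_control \<xi> \<tau> s)) (at s)"
proof -
  let ?S = "\<lambda>s. \<Sum>k. (s ^ k / fact k) *\<^sub>R (((**) (- \<tau>)) ^^ k) (mat 1)"
  have pow: "(((**) ((- s) *\<^sub>R \<tau>)) ^^ k) (mat 1) = s ^ k *\<^sub>R (((**) (- \<tau>)) ^^ k) (mat 1)" for s k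
  proof (induction k)
    case (Suc k)
    then show ?case
      by (simp add: matrix_matrix_mult_def vec_eq_iff sum_distrib_left mult_ac sum_negf)
  qed simp
  have S: "matrix_exp ((- s) *\<^sub>R \<tau>) = ?S s" for s
    unfolding matrix_exp_def pow by (simp add: field_simps)
  note ode = linear_ode_series[OF bounded_linear_matrix_mult[of "- \<tau>"], where z = "mat 1 :: real^4^4"]
  show "covector_control \<xi> \<tau> 0 = \<xi>"
    unfolding covector_control_def S ode(1) by simp
  have bl: "bounded_linear (\<lambda>A. A *v \<xi>)" for \<xi> :: "real^4"
    by (rule bounded_bilinear.bounded_linear_left[OF bounded_bilinear_matrix_vector_mult])
  have "((\<lambda>s. ?S s *v \<xi>) has_vector_derivative (- \<tau> ** ?S s) *v \<xi>) (at s)"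
    by (rule bounded_linear.has_vector_derivative[OF bl ode(2)])
  then show "(covector_control \<xi> \<tau> has_vector_derivative - (\<tau> *v covector_control \<xi> \<tau> s)) (at s)"
    unfolding covector_control_def S 
    by (simp add: matrix_vector_mul_assoc[symmetric] mvec.minus_left)
qed

text \<open>Since \<open>A\<close> is skew, it does not contribute to the derivative of \<open>\<parallel>y\<parallel>\<^sup>2\<close>. The bound is
  therefore independent of \<open>A\<close>, which makes the later estimates uniform in the covector. The
  constant 2 is a bound for \<open>\<surd>e\<close>.\<close>

lemma skew_ode_bound:
  fixes y f :: "real \<Rightarrow> real^4"
  assumes "A \<in> so4"
    and y: "\<And>s. (y has_vector_derivative - (A *v y s) + f s) (at s)"
    and f: "\<And>s. s \<in> {0..1} \<Longrightarrow> norm (f s) \<le> K"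
    and s: "s \<in> {0..1}"
  shows "norm (y s) \<le> 2 * (norm (y 0) + K)"
proof -
  have K: "K \<ge> 0" by (rule order_trans[OF norm_ge_zero f[of 0]]) simp
  \<comment> \<open>Gronwall: \<open>2 y \<bullet> f \<le> y \<bullet> y + K\<^sup>2\<close> makes this function nonincreasing.\<close>
  let ?g = "\<lambda>s. exp (- s) * (y s \<bullet> y s + K\<^sup>2)"
  have "?g s \<le> ?g 0"
  proof (rule DERIV_nonpos_imp_nonincreasing[of 0 s])
    show "0 \<le> s" using s by simp
    fix r assume r: "0 \<le> r" "r \<le> s"
    have "((\<lambda>s. y s \<bullet> y s) has_real_derivative 2 * (y r \<bullet> f r)) (at r)"
    proof -
      have "((\<lambda>s. y s \<bullet> y s) has_vector_derivative
          y r \<bullet> (- (A *v y r) + f r) + (- (A *v y r) + f r) \<bullet> y r) (at r)"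
        by (rule bounded_bilinear.has_vector_derivative[OF bounded_bilinear_inner y y])
      then show ?thesis
        using so4_inner_self[OF assms(1), of "y r"]
        by (simp add: has_real_derivative_iff_has_vector_derivative inner_commute inner_diff_right)
    qed
    then have D: "(?g has_real_derivative exp (- r) * (2 * (y r \<bullet> f r) - (y r \<bullet> y r + K\<^sup>2))) (at r)"
      by (auto intro!: derivative_eq_intros simp: algebra_simps)
    have "2 * (y r \<bullet> f r) \<le> y r \<bullet> y r + f r \<bullet> f r"
      using inner_ge_zero[of "y r - f r"] by (simp add: inner_diff inner_commute)
    moreover have "f r \<bullet> f r \<le> K\<^sup>2"
      using f[of r] r s K by (simp add: power2_norm_eq_inner[symmetric] power_mono)
    ultimately have "2 * (y r \<bullet> f r) - (y r \<bullet> y r + K\<^sup>2) \<le> 0" by simp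
    then have "exp (- r) * (2 * (y r \<bullet> f r) - (y r \<bullet> y r + K\<^sup>2)) \<le> 0"
      by (simp add: mult_nonneg_nonpos)
    with D show "\<exists>y. (?g has_real_derivative y) (at r) \<and> y \<le> 0" by blast
  qed
  then have "y s \<bullet> y s + K\<^sup>2 \<le> exp s * (y 0 \<bullet> y 0 + K\<^sup>2)"
    by (simp add: exp_minus field_simps)
  also have "\<dots> \<le> 4 * (y 0 \<bullet> y 0 + K\<^sup>2)"
  proof (rule mult_right_mono)
    have "exp s \<le> exp 1" using s by simp
    also have "\<dots> \<le> 4" using exp_le by simp
    finally show "exp s \<le> 4" .
  qed simp
  finally have "(norm (y s))\<^sup>2 \<le> 4 * ((norm (y 0))\<^sup>2 + K\<^sup>2)"
    unfolding power2_norm_eq_inner using zero_le_power2[of K] by linarith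
  also have "\<dots> \<le> (2 * (norm (y 0) + K))\<^sup>2"
    using K by (simp add: power2_eq_square algebra_simps)
  finally show ?thesis
    using K by (simp add: abs_le_square_iff[symmetric])
qed

lemma skew_ode_unique:
  fixes y z f :: "real \<Rightarrow> real^4"
  assumes "A \<in> so4"
    and y: "\<And>s. (y has_vector_derivative - (A *v y s) + f s) (at s)"
    and z: "\<And>s. (z has_vector_derivative - (A *v z s) + f s) (at s)"
    and 0: "y 0 = z 0"
  shows "y = z"
proof -
  define d where "d s = y s - z s" for s
  have d: "(d has_vector_derivative - (A *v d s)) (at s)" for s
    using has_vector_derivative_diff[OF y[of s] z[of s]]
    by (simp add: d_def[abs_def] mvec.diff_right)
  have "((\<lambda>s. d s \<bullet> d s) has_vector_derivative 0) (at s)" for s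
    using bounded_bilinear.has_vector_derivative[OF bounded_bilinear_inner d d, of s]
      so4_inner_self[OF assms(1), of "d s"] by (simp add: inner_commute)
  then have "(\<lambda>s. d s \<bullet> d s) = (\<lambda>s. 0)"
    by (rule has_vector_derivative_unique_from_0) (auto simp: d_def 0)
  then show ?thesis by (auto simp: d_def fun_eq_iff)
qed

lemma covector_control_eqI:
  assumes "\<tau> \<in> so4" "y 0 = \<xi>" "\<And>s. (y has_vector_derivative - (\<tau> *v y s)) (at s)"
  shows "covector_control \<xi> \<tau> = y"
  using skew_ode_unique[OF assms(1), of "covector_control \<xi> \<tau>" "\<lambda>_. 0" y]
    covector_control_ode[of \<xi> \<tau>] assms(2,3) by simp

lemma continuous_on_UNIV_if_has_vector_derivative:
  assumes "\<And>s. (f has_vector_derivative f' s) (at s)"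
  shows "continuous_on UNIV f"
  by (intro continuous_at_imp_continuous_on ballI has_vector_derivative_continuous[OF assms])

lemmas continuous_covector_control =
  continuous_on_UNIV_if_has_vector_derivative[OF covector_control_ode(2)]

lemma curve_eqI:
  assumes "continuous_on UNIV u" "is_curve u \<gamma>"
  shows "curve u = \<gamma>"
proof -
  have "\<exists>!\<gamma>. is_curve u \<gamma>" by (rule ex1_is_curve) fact
  then show ?thesis using assms(2) is_curve_curve[OF assms(1)] by blast
qed

section \<open>Differentiability of the exponential\<close>

lemma norm_le_of_derivative_bound:
  fixes y :: "real \<Rightarrow> 'a::real_normed_vector"
  assumes y: "\<And>s. (y has_vector_derivative f s) (at s)" and "y 0 = 0"
    and f: "\<And>s. s \<in> {0..1} \<Longrightarrow> norm (f s) \<le> K"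
    and s: "s \<in> {0..1}"
  shows "norm (y s) \<le> K"
proof -
  have K: "0 \<le> K" by (rule order_trans[OF norm_ge_zero f[of 0]]) simp
  have "norm (y s - y 0) \<le> K * norm (s - 0)"
  proof (rule differentiable_bound[of "{0..1}"])
    fix r :: real assume r: "r \<in> {0..1}"
    show "(y has_derivative (\<lambda>h. h *\<^sub>R f r)) (at r within {0..1})"
      using y[of r] by (simp add: has_vector_derivative_def has_derivative_at_withinI)
    show "onorm (\<lambda>h. h *\<^sub>R f r) \<le> K"
      using f[OF r] by (intro onorm_bound K) (simp add: mult.commute[of K] mult_left_mono)
  qed (use s in auto)
  also have "\<dots> \<le> K * 1" using s K by (intro mult_left_mono) auto
  finally show ?thesis using \<open>y 0 = 0\<close> by simp
qed

text \<open>The control and its variation together solve one autonomous linear equation on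
  \<open>\<real>\<^sup>4 \<times> \<real>\<^sup>4\<close>, so the exponential series provides both.\<close>

lemma linearised_control_exists:
  assumes "\<tau> \<in> so4"
  shows "\<exists>w. w 0 = \<eta> \<and>
    (\<forall>s. (w has_vector_derivative - (\<tau> *v w s) + - (\<sigma> *v covector_control \<xi> \<tau> s)) (at s))"
proof -
  define L :: "(real^4) \<times> (real^4) \<Rightarrow> (real^4) \<times> (real^4)"
    where "L = (\<lambda>(u, w). (- (\<tau> *v u), - (\<tau> *v w) + - (\<sigma> *v u)))"
  have L: "bounded_linear L"
    unfolding linear_conv_bounded_linear[symmetric] L_def
    by (rule linearI) (auto simp: mvec.add_right mvec.scaleR_right algebra_simps)
  obtain S where S0: "S 0 = (\<xi>, \<eta>)" and S: "\<And>s. (S has_vector_derivative L (S s)) (at s)"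
    by (rule that[OF linear_ode_series(1,2)[OF L, where z = "(\<xi>, \<eta>)"]])
  have u: "covector_control \<xi> \<tau> = (\<lambda>s. fst (S s))"
    using bounded_linear.has_vector_derivative[OF bounded_linear_fst S] S0
    by (intro covector_control_eqI assms) (auto simp: L_def split_def)
  show ?thesis
  proof (intro exI conjI allI)
    show "snd (S 0) = \<eta>" by (simp add: S0)
    show "((\<lambda>s. snd (S s)) has_vector_derivative
        - (\<tau> *v snd (S s)) + - (\<sigma> *v covector_control \<xi> \<tau> s)) (at s)" for s
      using bounded_linear.has_vector_derivative[OF bounded_linear_snd S[of s]]
      by (simp add: u L_def split_def)
  qed
qed

lemma curve_covector_control:
  fixes \<xi> \<tau> defines "g \<equiv> curve (covector_control \<xi> \<tau>)"
  shows "fst (g 0) = 0" and "snd (g 0) = 0"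
    and "((\<lambda>s. fst (g s)) has_vector_derivative covector_control \<xi> \<tau> s) (at s)"
    and "((\<lambda>s. snd (g s)) has_vector_derivative
           (1/2) *\<^sub>R wedge (fst (g s)) (covector_control \<xi> \<tau> s)) (at s)"
proof -
  have *: "is_curve (covector_control \<xi> \<tau>) g"
    unfolding g_def by (rule is_curve_curve[OF continuous_covector_control])
  show "fst (g 0) = 0" "snd (g 0) = 0" using * by (simp_all add: is_curve_def)
  have D: "(g has_vector_derivative
      (covector_control \<xi> \<tau> s, (1/2) *\<^sub>R wedge (fst (g s)) (covector_control \<xi> \<tau> s))) (at s)"
    using * by (simp add: is_curve_def)
  show "((\<lambda>s. fst (g s)) has_vector_derivative covector_control \<xi> \<tau> s) (at s)"
    using bounded_linear.has_vector_derivative[OF bounded_linear_fst D] by simp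
  show "((\<lambda>s. snd (g s)) has_vector_derivative
           (1/2) *\<^sub>R wedge (fst (g s)) (covector_control \<xi> \<tau> s)) (at s)"
    using bounded_linear.has_vector_derivative[OF bounded_linear_snd D] by simp
qed

lemma norm_covector_control_le:
  assumes "\<tau> \<in> so4" "s \<in> {0..1}"
  shows "norm (covector_control \<xi> \<tau> s) \<le> 2 * norm \<xi>"
  using skew_ode_bound[OF assms(1), of "covector_control \<xi> \<tau>" "\<lambda>_. 0" 0 s]
    covector_control_ode[of \<xi> \<tau>] assms(2) by simp

text \<open>The candidate for the differential in direction \<open>h = (\<eta>, \<sigma>)\<close> is the endpoint
  \<open>(Y h 1, V h 1)\<close> of the linearised system: \<open>W h\<close> is the variation of the control,
  \<open>Y h\<close> and \<open>V h\<close> those of the two components of the curve. Uniqueness for the control equation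
  makes it linear in \<open>h\<close>. The remainder is quadratic in \<open>h\<close> because each of its
  differential equations has a source term of second order: for the control the source is
  \<open>- \<sigma> d\<close>, where \<open>d\<close> is the difference of the two controls and hence of first order.\<close>

lemma sR_exp_differentiable:
  assumes \<tau>: "\<tau> \<in> so4"
  shows "\<exists>D. (sR_exp has_derivative D) (at (\<xi>, \<tau>) within UNIV \<times> so4)"
proof -
  define u where "u = covector_control \<xi> \<tau>"
  define x where "x s = fst (curve u s)" for s
  define t where "t s = snd (curve u s)" for s
  note u = covector_control_ode[of \<xi> \<tau>, folded u_def]
  have x: "x 0 = 0" "(x has_vector_derivative u s) (at s)"
   and t: "t 0 = 0" "(t has_vector_derivative (1/2) *\<^sub>R wedge (x s) (u s)) (at s)" for s
    using curve_covector_control[of \<xi> \<tau>] by (simp_all add: x_def[abs_def] t_def[abs_def] u_def)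
  have cont_u: "continuous_on UNIV u" and cont_x: "continuous_on UNIV x"
    by (rule continuous_on_UNIV_if_has_vector_derivative[OF u(2)]
        continuous_on_UNIV_if_has_vector_derivative[OF x(2)])+

  have "\<exists>w. w 0 = fst h \<and>
    (\<forall>s. (w has_vector_derivative - (\<tau> *v w s) + - (snd h *v u s)) (at s))"
    for h :: "(real^4) \<times> (real^4^4)"
    unfolding u_def by (rule linearised_control_exists[OF \<tau>])
  then obtain W where W: "\<And>h. W h 0 = fst h"
    "\<And>h s. (W h has_vector_derivative - (\<tau> *v W h s) + - (snd h *v u s)) (at s)"
    by metis
  have cont_W: "continuous_on UNIV (W h)" for h
    by (rule continuous_on_UNIV_if_has_vector_derivative[OF W(2)])
  have "\<exists>y. y 0 = 0 \<and> (\<forall>s. (y has_vector_derivative W h s) (at s))" for h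
    using antiderivative_from_0[OF cont_W] by metis
  then obtain Y where Y: "\<And>h. Y h 0 = 0" "\<And>h s. (Y h has_vector_derivative W h s) (at s)"
    by metis
  have cont_Y: "continuous_on UNIV (Y h)" for h
    by (rule continuous_on_UNIV_if_has_vector_derivative[OF Y(2)])
  define v where "v h s = (1/2) *\<^sub>R (wedge (Y h s) (u s) + wedge (x s) (W h s))" for h s
  have "continuous_on UNIV (v h)" for h
    unfolding v_def by (intro continuous_intros wedge.continuous_on cont_u cont_x cont_W cont_Y)
  then have "\<exists>y. y 0 = 0 \<and> (\<forall>s. (y has_vector_derivative v h s) (at s))" for h
    using antiderivative_from_0 by metis
  then obtain V where V: "\<And>h. V h 0 = 0" "\<And>h s. (V h has_vector_derivative v h s) (at s)"
    by metis

  have W_add: "W (h + k) = (\<lambda>s. W h s + W k s)" for h k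
  proof (rule skew_ode_unique[OF \<tau> W(2)])
    show "((\<lambda>s. W h s + W k s) has_vector_derivative
        - (\<tau> *v (W h s + W k s)) + - (snd (h + k) *v u s)) (at s)" for s
      using has_vector_derivative_add[OF W(2)[of h s] W(2)[of k s]]
      by (simp add: mvec.add_right mvec.add_left algebra_simps)
  qed (simp add: W)
  have W_scale: "W (c *\<^sub>R h) = (\<lambda>s. c *\<^sub>R W h s)" for c h
  proof (rule skew_ode_unique[OF \<tau> W(2)])
    show "((\<lambda>s. c *\<^sub>R W h s) has_vector_derivative
        - (\<tau> *v (c *\<^sub>R W h s)) + - (snd (c *\<^sub>R h) *v u s)) (at s)" for s
      using has_vector_derivative_scaleR[OF DERIV_const W(2)[of h s], of c]
      by (simp add: mvec.scaleR_right mvec.scaleR_left algebra_simps)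
  qed (simp add: W)
  have Y_add: "Y (h + k) = (\<lambda>s. Y h s + Y k s)" for h k
    by (rule has_vector_derivative_unique_from_0[OF Y(2)])
       (simp_all add: W_add Y has_vector_derivative_add)
  have Y_scale: "Y (c *\<^sub>R h) = (\<lambda>s. c *\<^sub>R Y h s)" for c h
    by (rule has_vector_derivative_unique_from_0[OF Y(2)])
       (auto simp: W_scale Y(1) intro!: derivative_eq_intros Y(2))
  have V_add: "V (h + k) = (\<lambda>s. V h s + V k s)" for h k
  proof (rule has_vector_derivative_unique_from_0[OF V(2)])
    show "((\<lambda>s. V h s + V k s) has_vector_derivative v (h + k) s) (at s)" for s
      using has_vector_derivative_add[OF V(2)[of h s] V(2)[of k s]]
      by (simp add: v_def W_add Y_add wedge.add_left wedge.add_right algebra_simps)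
  qed (simp add: V)
  have V_scale: "V (c *\<^sub>R h) = (\<lambda>s. c *\<^sub>R V h s)" for c h
  proof (rule has_vector_derivative_unique_from_0[OF V(2)])
    show "((\<lambda>s. c *\<^sub>R V h s) has_vector_derivative v (c *\<^sub>R h) s) (at s)" for s
      using has_vector_derivative_scaleR[OF DERIV_const V(2)[of h s], of c]
      by (simp add: v_def W_scale Y_scale wedge.scaleR_left wedge.scaleR_right algebra_simps)
  qed (simp add: V)

  define D where "D h = (Y h 1, V h 1)" for h
  have D: "bounded_linear D"
    unfolding linear_conv_bounded_linear[symmetric] D_def
    by (rule linearI) (simp_all add: Y_add Y_scale V_add V_scale)

  obtain B where B: "B \<ge> 0" "\<And>(A::real^4^4) (z::real^4). norm (A *v z) \<le> norm A * norm z * B"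
    using mvec.nonneg_bounded by blast
  obtain C where C: "C \<ge> 0" "\<And>a b. norm (wedge a b) \<le> norm a * norm b * C"
    using wedge.nonneg_bounded by blast
  define a where "a = 2 * (norm \<xi> + 1)"
  define b where "b = 2 * (1 + a * B)"
  define c where "c = 2 * (b * B)"
  define k where "k = (2 * a * c + b * b) * C"
  have pos: "a \<ge> 0" "b \<ge> 0" "c \<ge> 0" "k \<ge> 0"
    using B(1) C(1) by (simp_all add: a_def b_def c_def k_def)

  have remainder: "norm (sR_exp ((\<xi>, \<tau>) + h) - sR_exp (\<xi>, \<tau>) - D h) \<le> (norm h)\<^sup>2 * (c + k)"
    if h: "snd h \<in> so4" "norm h \<le> 1" for h
  proof -
    define \<eta> where "\<eta> = fst h"
    define \<sigma> where "\<sigma> = snd h"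
    define n where "n = norm h"
    have ph: "(\<xi>, \<tau>) + h = (\<xi> + \<eta>, \<tau> + \<sigma>)"
      by (simp add: \<eta>_def \<sigma>_def prod_eq_iff)
    have n: "norm \<eta> \<le> n" "norm \<sigma> \<le> n" "n \<le> 1" "n \<ge> 0"
      using h norm_fst_le[of "fst h" "snd h"] norm_snd_le[of "snd h" "fst h"] by (auto simp: \<eta>_def \<sigma>_def n_def)
    have \<tau>\<sigma>: "\<tau> + \<sigma> \<in> so4"
      using subspace_add[OF subspace_so4 \<tau>] h by (simp add: \<sigma>_def)
    define u' where "u' = covector_control (\<xi> + \<eta>) (\<tau> + \<sigma>)"
    define x' where "x' s = fst (curve u' s)" for s
    define t' where "t' s = snd (curve u' s)" for s
    note u' = covector_control_ode[of "\<xi> + \<eta>" "\<tau> + \<sigma>", folded u'_def]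
    have x': "x' 0 = 0" "(x' has_vector_derivative u' s) (at s)"
     and t': "t' 0 = 0" "(t' has_vector_derivative (1/2) *\<^sub>R wedge (x' s) (u' s)) (at s)" for s
      using curve_covector_control[of "\<xi> + \<eta>" "\<tau> + \<sigma>"]
      by (simp_all add: x'_def[abs_def] t'_def[abs_def] u'_def)
    \<comment> \<open>First-order differences are bounded by multiples of \<open>n\<close>, the remainders \<open>z\<close> and \<open>e\<close> by multiples of \<open>n\<^sup>2\<close>.\<close>
    define d where "d s = u' s - u s" for s
    define z where "z s = d s - W h s" for s
    define e where "e s = x' s - x s - Y h s" for s
    have u_le: "norm (u s) \<le> a" and u'_le: "norm (u' s) \<le> a" if "s \<in> {0..1}" for s
    proof -
      show "norm (u s) \<le> a"
        using norm_covector_control_le[OF \<tau> that, of \<xi>] by (simp add: u_def a_def)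
      show "norm (u' s) \<le> a"
        using norm_covector_control_le[OF \<tau>\<sigma> that, of "\<xi> + \<eta>"] norm_triangle_ineq[of \<xi> \<eta>] n
        by (simp add: u'_def a_def)
    qed
    have d_le: "norm (d s) \<le> n * b" if s: "s \<in> {0..1}" for s
    proof -
      have "norm (d s) \<le> 2 * (norm (d 0) + n * a * B)"
      proof (rule skew_ode_bound[OF \<tau> _ _ s])
        show "(d has_vector_derivative - (\<tau> *v d s) + - (\<sigma> *v u' s)) (at s)" for s
          using has_vector_derivative_diff[OF u'(2)[of s] u(2)[of s]]
          by (simp add: d_def[abs_def] mvec.diff_right mvec.add_left algebra_simps)
        fix s :: real assume s: "s \<in> {0..1}"
        have "norm (- (\<sigma> *v u' s)) \<le> norm \<sigma> * norm (u' s) * B" using B(2) by simp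
        also have "\<dots> \<le> n * a * B"
          using n u'_le[OF s] pos B(1) by (intro mult_right_mono mult_mono) auto
        finally show "norm (- (\<sigma> *v u' s)) \<le> n * a * B" .
      qed
      also have "\<dots> \<le> n * b" using n by (simp add: d_def u u' b_def algebra_simps)
      finally show ?thesis .
    qed
    have z_le: "norm (z s) \<le> n\<^sup>2 * c" if s: "s \<in> {0..1}" for s
    proof -
      have "norm (z s) \<le> 2 * (norm (z 0) + n * (n * b) * B)"
      proof (rule skew_ode_bound[OF \<tau> _ _ s])
        show "(z has_vector_derivative - (\<tau> *v z s) + - (\<sigma> *v d s)) (at s)" for s
          using has_vector_derivative_diff[OF has_vector_derivative_diff[OF u'(2)[of s] u(2)[of s]] W(2)[of h s]]
          by (simp add: z_def[abs_def] d_def[abs_def] mvec.diff_right mvec.add_left \<sigma>_def algebra_simps)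
        fix s :: real assume s: "s \<in> {0..1}"
        have "norm (- (\<sigma> *v d s)) \<le> norm \<sigma> * norm (d s) * B" using B(2) by simp
        also have "\<dots> \<le> n * (n * b) * B"
          using n d_le[OF s] pos B(1) by (intro mult_right_mono mult_mono) auto
        finally show "norm (- (\<sigma> *v d s)) \<le> n * (n * b) * B" .
      qed
      also have "\<dots> = n\<^sup>2 * c" by (simp add: z_def d_def u u' W \<eta>_def c_def power2_eq_square)
      finally show ?thesis .
    qed
    have x_le: "norm (x s) \<le> a" if "s \<in> {0..1}" for s
      by (rule norm_le_of_derivative_bound[OF x(2) x(1) u_le that])
    have dx_le: "norm (x' s - x s) \<le> n * b" if "s \<in> {0..1}" for s
      by (rule norm_le_of_derivative_bound[OF has_vector_derivative_diff[OF x'(2) x(2)] _ _ that])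
         (use d_le in \<open>auto simp: x x' d_def\<close>)
    have e: "(e has_vector_derivative z s) (at s)" for s
      using has_vector_derivative_diff[OF has_vector_derivative_diff[OF x'(2)[of s] x(2)[of s]] Y(2)[of h s]]
      by (simp add: e_def[abs_def] z_def d_def)
    have e_le: "norm (e s) \<le> n\<^sup>2 * c" if "s \<in> {0..1}" for s
      by (rule norm_le_of_derivative_bound[OF e _ z_le that]) (auto simp: e_def x x' Y)
    have "norm (t' 1 - t 1 - V h 1) \<le> n\<^sup>2 * k"
    proof (rule norm_le_of_derivative_bound[where y = "\<lambda>s. t' s - t s - V h s"])
      fix s :: real
      let ?f = "(1/2) *\<^sub>R (wedge (e s) (u s) + wedge (x s) (z s) + wedge (x' s - x s) (d s))"
      have "wedge (x' s) (u' s) - wedge (x s) (u s) - (wedge (Y h s) (u s) + wedge (x s) (W h s))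
          = wedge (e s) (u s) + wedge (x s) (z s) + wedge (x' s - x s) (d s)"
        by (simp add: e_def z_def d_def wedge.diff_left wedge.diff_right wedge.add_left wedge.add_right)
      then have "(1/2) *\<^sub>R wedge (x' s) (u' s) - (1/2) *\<^sub>R wedge (x s) (u s) - v h s = ?f"
        unfolding v_def scaleR_diff_right[symmetric] by simp
      then show "((\<lambda>s. t' s - t s - V h s) has_vector_derivative ?f) (at s)"
        using has_vector_derivative_diff[OF has_vector_derivative_diff[OF t'(2)[of s] t(2)[of s]] V(2)[of h s]]
        by simp
      assume s: "s \<in> {0..1}"
      have "norm (wedge (e s) (u s)) \<le> norm (e s) * norm (u s) * C" by (rule C)
      also have "\<dots> \<le> n\<^sup>2 * c * a * C"
        using e_le[OF s] u_le[OF s] pos C(1) by (intro mult_right_mono mult_mono) auto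
      finally have 1: "norm (wedge (e s) (u s)) \<le> n\<^sup>2 * c * a * C" .
      have "norm (wedge (x s) (z s)) \<le> norm (x s) * norm (z s) * C" by (rule C)
      also have "\<dots> \<le> a * (n\<^sup>2 * c) * C"
        using x_le[OF s] z_le[OF s] pos C(1) by (intro mult_right_mono mult_mono) auto
      finally have 2: "norm (wedge (x s) (z s)) \<le> a * (n\<^sup>2 * c) * C" .
      have "norm (wedge (x' s - x s) (d s)) \<le> norm (x' s - x s) * norm (d s) * C" by (rule C)
      also have "\<dots> \<le> n * b * (n * b) * C"
        using dx_le[OF s] d_le[OF s] pos n C(1) by (intro mult_right_mono mult_mono) auto
      finally have 3: "norm (wedge (x' s - x s) (d s)) \<le> n * b * (n * b) * C" .
      have "norm ?f \<le> norm (wedge (e s) (u s) + wedge (x s) (z s) + wedge (x' s - x s) (d s))"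
        by simp
      also have "\<dots> \<le> n\<^sup>2 * c * a * C + a * (n\<^sup>2 * c) * C + n * b * (n * b) * C"
        by (intro norm_triangle_le add_mono 1 2 3)
      also have "\<dots> = n\<^sup>2 * k" by (simp add: k_def power2_eq_square algebra_simps)
      finally show "norm ?f \<le> n\<^sup>2 * k" .
    qed (auto simp: t t' V)
    moreover have "norm (x' 1 - x 1 - Y h 1) \<le> n\<^sup>2 * c"
      using e_le[of 1] by (simp add: e_def)
    moreover have "sR_exp ((\<xi>, \<tau>) + h) - sR_exp (\<xi>, \<tau>) - D h
        = (x' 1 - x 1 - Y h 1, t' 1 - t 1 - V h 1)"
      unfolding ph
      by (simp add: sR_exp_def D_def x_def t_def x'_def t'_def u_def u'_def prod_eq_iff)
    ultimately show ?thesis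
      using norm_Pair_le[of "x' 1 - x 1 - Y h 1" "t' 1 - t 1 - V h 1"]
      by (simp add: n_def algebra_simps)
  qed

  have "(sR_exp has_derivative D) (at (\<xi>, \<tau>) within UNIV \<times> so4)"
  proof (rule has_derivativeI_sandwich[OF zero_less_one D])
    fix p assume p: "p \<in> UNIV \<times> so4" "p \<noteq> (\<xi>, \<tau>)" "dist p (\<xi>, \<tau>) < 1"
    define h where "h = p - (\<xi>, \<tau>)"
    have h: "snd h \<in> so4" "norm h \<le> 1" "norm h > 0" "p = (\<xi>, \<tau>) + h"
      using p subspace_diff[OF subspace_so4 _ \<tau>] by (auto simp: h_def dist_norm)
    show "norm (sR_exp p - sR_exp (\<xi>, \<tau>) - D (p - (\<xi>, \<tau>))) / norm (p - (\<xi>, \<tau>))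
        \<le> norm (p - (\<xi>, \<tau>)) * (c + k)"
      using remainder[OF h(1,2)] h(3)
      by (simp add: h(4) pos_divide_le_eq power2_eq_square algebra_simps)
  next
    show "((\<lambda>p. norm (p - (\<xi>, \<tau>)) * (c + k)) \<longlongrightarrow> 0) (at (\<xi>, \<tau>) within UNIV \<times> so4)"
      by (auto intro!: tendsto_eq_intros)
  qed
  then show ?thesis by blast
qed

section \<open>The explicit endpoint in a frame\<close>

definition orthonormal4 :: "'a::real_inner \<Rightarrow> 'a \<Rightarrow> 'a \<Rightarrow> 'a \<Rightarrow> bool" where
  "orthonormal4 u1 v1 u2 v2 \<longleftrightarrow>
     u1 \<bullet> u1 = 1 \<and> v1 \<bullet> v1 = 1 \<and> u2 \<bullet> u2 = 1 \<and> v2 \<bullet> v2 = 1 \<and>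
     u1 \<bullet> v1 = 0 \<and> u1 \<bullet> u2 = 0 \<and> u1 \<bullet> v2 = 0 \<and> v1 \<bullet> u2 = 0 \<and> v1 \<bullet> v2 = 0 \<and> u2 \<bullet> v2 = 0"

lemma orthonormal4_inner:
  assumes "orthonormal4 u1 v1 u2 v2"
  shows "u1 \<bullet> u1 = 1" "v1 \<bullet> v1 = 1" "u2 \<bullet> u2 = 1" "v2 \<bullet> v2 = 1"
    "u1 \<bullet> v1 = 0" "u1 \<bullet> u2 = 0" "u1 \<bullet> v2 = 0" "v1 \<bullet> u2 = 0" "v1 \<bullet> v2 = 0" "u2 \<bullet> v2 = 0"
    "v1 \<bullet> u1 = 0" "u2 \<bullet> u1 = 0" "v2 \<bullet> u1 = 0" "u2 \<bullet> v1 = 0" "v2 \<bullet> v1 = 0" "v2 \<bullet> u2 = 0"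
  using assms by (auto simp: orthonormal4_def inner_commute)

text \<open>The covector with frame \<open>u1, v1, u2, v2\<close>, radii \<open>r1, r2\<close> and angles \<open>\<phi>1, \<phi>2\<close>.
  Each plane carries its part of \<open>\<xi>\<close> at angle \<open>\<phi>\<close> from \<open>v\<close>: the control
  then turns symmetrically about \<open>v\<close> during the unit time interval, which is why the endpoint in
  \<open>\<real>\<^sup>4\<close> has no component along \<open>u\<close>.\<close>

definition covector ::
    "real^4 \<Rightarrow> real^4 \<Rightarrow> real^4 \<Rightarrow> real^4 \<Rightarrow> real \<Rightarrow> real \<Rightarrow> real \<Rightarrow> real \<Rightarrow> (real^4) \<times> (real^4^4)" where
  "covector u1 v1 u2 v2 r1 r2 \<phi>1 \<phi>2 =
     ((r1 * sin \<phi>1) *\<^sub>R u1 + (r1 * cos \<phi>1) *\<^sub>R v1 + (r2 * sin \<phi>2) *\<^sub>R u2 + (r2 * cos \<phi>2) *\<^sub>R v2,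
      (2 * \<phi>1) *\<^sub>R wedge u1 v1 + (2 * \<phi>2) *\<^sub>R wedge u2 v2)"

text \<open>The closed form of \<open>e\<^sup>-\<^sup>s\<^sup>\<tau>\<xi>\<close> for these covectors.\<close>

definition frame_control ::
    "real^4 \<Rightarrow> real^4 \<Rightarrow> real^4 \<Rightarrow> real^4 \<Rightarrow> real \<Rightarrow> real \<Rightarrow> real \<Rightarrow> real \<Rightarrow> real \<Rightarrow> real^4" where
  "frame_control u1 v1 u2 v2 r1 r2 \<phi>1 \<phi>2 s =
     (r1 * sin (\<phi>1 * (1 - 2 * s))) *\<^sub>R u1 + (r1 * cos (\<phi>1 * (1 - 2 * s))) *\<^sub>R v1
   + (r2 * sin (\<phi>2 * (1 - 2 * s))) *\<^sub>R u2 + (r2 * cos (\<phi>2 * (1 - 2 * s))) *\<^sub>R v2"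

definition endpoint ::
    "real^4 \<Rightarrow> real^4 \<Rightarrow> real^4 \<Rightarrow> real^4 \<Rightarrow> real \<Rightarrow> real \<Rightarrow> real \<Rightarrow> real \<Rightarrow> point" where
  "endpoint u1 v1 u2 v2 r1 r2 \<phi>1 \<phi>2 =
     ((r1 * T \<phi>1) *\<^sub>R v1 + (r2 * T \<phi>2) *\<^sub>R v2,
      (r1\<^sup>2 * U \<phi>1) *\<^sub>R wedge u1 v1
    + (r1 * r2 * Z \<phi>1 \<phi>2) *\<^sub>R wedge u1 v2
    + (r1 * r2 * Z \<phi>2 \<phi>1) *\<^sub>R wedge u2 v1
    + (r2\<^sup>2 * U \<phi>2) *\<^sub>R wedge u2 v2)"

lemma snd_covector_in_so4: "snd (covector u1 v1 u2 v2 r1 r2 \<phi>1 \<phi>2) \<in> so4"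
  by (simp add: covector_def subspace_add subspace_so4 subspace_scale)

lemma covector_control_frame:
  assumes "orthonormal4 u1 v1 u2 v2" and "(\<xi>, \<tau>) = covector u1 v1 u2 v2 r1 r2 \<phi>1 \<phi>2"
  shows "covector_control \<xi> \<tau> = frame_control u1 v1 u2 v2 r1 r2 \<phi>1 \<phi>2"
proof (rule covector_control_eqI)
  show "\<tau> \<in> so4"
    using snd_covector_in_so4[of u1 v1 u2 v2 r1 r2 \<phi>1 \<phi>2] assms(2)[symmetric] by simp
  show "frame_control u1 v1 u2 v2 r1 r2 \<phi>1 \<phi>2 0 = \<xi>"
    using assms(2) by (simp add: frame_control_def covector_def)
  fix s :: real
  let ?\<theta>1 = "\<phi>1 * (1 - 2 * s)" and ?\<theta>2 = "\<phi>2 * (1 - 2 * s)"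
  have "\<tau> = (2 * \<phi>1) *\<^sub>R wedge u1 v1 + (2 * \<phi>2) *\<^sub>R wedge u2 v2"
    using assms(2) by (simp add: covector_def)
  then have "- (\<tau> *v frame_control u1 v1 u2 v2 r1 r2 \<phi>1 \<phi>2 s)
      = (r1 * (cos ?\<theta>1 * (- 2 * \<phi>1))) *\<^sub>R u1 + (r1 * (sin ?\<theta>1 * (2 * \<phi>1))) *\<^sub>R v1
      + (r2 * (cos ?\<theta>2 * (- 2 * \<phi>2))) *\<^sub>R u2 + (r2 * (sin ?\<theta>2 * (2 * \<phi>2))) *\<^sub>R v2"
    by (simp add: frame_control_def mvec.add_left mvec.scaleR_left wedge_mult_vec
        inner_add_right orthonormal4_inner[OF assms(1)] algebra_simps)
  moreover have "(frame_control u1 v1 u2 v2 r1 r2 \<phi>1 \<phi>2 has_vector_derivative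
        (r1 * (cos ?\<theta>1 * (- 2 * \<phi>1))) *\<^sub>R u1 + (r1 * (sin ?\<theta>1 * (2 * \<phi>1))) *\<^sub>R v1
      + (r2 * (cos ?\<theta>2 * (- 2 * \<phi>2))) *\<^sub>R u2 + (r2 * (sin ?\<theta>2 * (2 * \<phi>2))) *\<^sub>R v2) (at s)"
    unfolding frame_control_def[abs_def]
    by (auto intro!: derivative_eq_intros simp: algebra_simps)
  ultimately show "(frame_control u1 v1 u2 v2 r1 r2 \<phi>1 \<phi>2 has_vector_derivative
      - (\<tau> *v frame_control u1 v1 u2 v2 r1 r2 \<phi>1 \<phi>2 s)) (at s)"
    by simp
qed

lemma wedge_frame_combination:
  "wedge (a1 *\<^sub>R u1 + b1 *\<^sub>R v1 + a2 *\<^sub>R u2 + b2 *\<^sub>R v2) (c1 *\<^sub>R u1 + d1 *\<^sub>R v1 + c2 *\<^sub>R u2 + d2 *\<^sub>R v2)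
   = (a1 * d1 - b1 * c1) *\<^sub>R wedge u1 v1 + (a1 * d2 - b2 * c1) *\<^sub>R wedge u1 v2
   + (a2 * d1 - b1 * c2) *\<^sub>R wedge u2 v1 + (a2 * d2 - b2 * c2) *\<^sub>R wedge u2 v2
   + (a1 * c2 - a2 * c1) *\<^sub>R wedge u1 u2 + (b1 * d2 - b2 * d1) *\<^sub>R wedge v1 v2"
  by (simp add: wedge_def vec_eq_iff algebra_simps)

text \<open>The integrands below are half the coefficients of the basic bivectors in \<open>x \<and> u\<close>, divided by
  the radii. With \<open>\<theta> = \<phi> (1 - 2 s)\<close> the curve has, up to the factor \<open>r\<close>, coordinates
  \<open>(cos \<theta> - cos \<phi>) / (2 \<phi>)\<close> along \<open>u\<close> and \<open>(sin \<phi> - sin \<theta>) / (2 \<phi>)\<close> along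
  \<open>v\<close>.\<close>

lemma area_primitive_same:
  fixes \<phi> :: real
  assumes "\<phi> \<noteq> 0"
  defines "\<theta> \<equiv> \<lambda>s. \<phi> * (1 - 2 * s)"
  shows "\<exists>F. (\<forall>s. (F has_real_derivative
      (1/2) * ((cos (\<theta> s) - cos \<phi>) / (2 * \<phi>) * cos (\<theta> s) - (sin \<phi> - sin (\<theta> s)) / (2 * \<phi>) * sin (\<theta> s))) (at s))
    \<and> F 0 = 0 \<and> F 1 = U \<phi>"
proof (intro exI conjI allI)
  let ?F = "\<lambda>s. (s - (cos \<phi> * (sin \<phi> - sin (\<theta> s)) + sin \<phi> * (cos (\<theta> s) - cos \<phi>)) / (2 * \<phi>)) / (4 * \<phi>)"
  show "?F 0 = 0" by (simp add: \<theta>_def)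
  show "?F 1 = U \<phi>" using assms(1) by (simp add: \<theta>_def U_def field_simps power2_eq_square)
  fix s
  have sq: "sin t * sin t = 1 - cos t * cos t" for t :: real
    using sin_cos_squared_add[of t] by (simp add: power2_eq_square)
  show "(?F has_real_derivative
      (1/2) * ((cos (\<theta> s) - cos \<phi>) / (2 * \<phi>) * cos (\<theta> s) - (sin \<phi> - sin (\<theta> s)) / (2 * \<phi>) * sin (\<theta> s))) (at s)"
    unfolding \<theta>_def using assms(1)
    by (auto intro!: derivative_eq_intros simp: field_simps sq)
qed

lemma primitive_from_0:
  fixes F :: "real \<Rightarrow> real"
  assumes "\<And>s. (F has_real_derivative f s) (at s)" and "F 1 - F 0 = c"
  shows "\<exists>G. (\<forall>s. (G has_real_derivative f s) (at s)) \<and> G 0 = 0 \<and> G 1 = c"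
  using assms by (intro exI[of _ "\<lambda>s. F s - F 0"]) (auto intro!: derivative_eq_intros)

lemma single_primitives:
  fixes \<omega> :: real
  assumes "\<omega> \<noteq> 0"
  shows "((\<lambda>s. - sin (\<omega> * (1 - 2 * s)) / (2 * \<omega>)) has_real_derivative cos (\<omega> * (1 - 2 * s))) (at s)"
    and "((\<lambda>s. cos (\<omega> * (1 - 2 * s)) / (2 * \<omega>)) has_real_derivative sin (\<omega> * (1 - 2 * s))) (at s)"
  using assms by (auto intro!: derivative_eq_intros)

context
  fixes \<phi> \<psi> :: real
  assumes nz: "\<phi> \<noteq> 0" "\<psi> \<noteq> 0" and ne: "\<phi>\<^sup>2 \<noteq> \<psi>\<^sup>2"
begin

abbreviation (input) "\<theta> s \<equiv> \<phi> * (1 - 2 * s)"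
abbreviation (input) "\<eta> s \<equiv> \<psi> * (1 - 2 * s)"

text \<open>Differentiation maps the span of \<open>cos \<theta> sin \<eta>\<close> and \<open>sin \<theta> cos \<eta>\<close> onto that of
  \<open>cos \<theta> cos \<eta>\<close> and \<open>sin \<theta> sin \<eta>\<close>, and conversely, each time with determinant
  \<open>\<plusminus>4 (\<phi>\<^sup>2 - \<psi>\<^sup>2)\<close>. This is where \<open>\<phi>\<^sup>2 \<noteq> \<psi>\<^sup>2\<close> enters.\<close>

lemma product_primitives:
  defines "\<Delta> \<equiv> 2 * (\<phi>\<^sup>2 - \<psi>\<^sup>2)"
  shows "((\<lambda>s. (\<psi> * cos (\<theta> s) * sin (\<eta> s) - \<phi> * sin (\<theta> s) * cos (\<eta> s)) / \<Delta>)
           has_real_derivative cos (\<theta> s) * cos (\<eta> s)) (at s)"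
    and "((\<lambda>s. (\<phi> * cos (\<theta> s) * sin (\<eta> s) - \<psi> * sin (\<theta> s) * cos (\<eta> s)) / \<Delta>)
           has_real_derivative sin (\<theta> s) * sin (\<eta> s)) (at s)"
    and "((\<lambda>s. (\<phi> * cos (\<theta> s) * cos (\<eta> s) + \<psi> * sin (\<theta> s) * sin (\<eta> s)) / \<Delta>)
           has_real_derivative sin (\<theta> s) * cos (\<eta> s)) (at s)"
    and "((\<lambda>s. - (\<psi> * cos (\<theta> s) * cos (\<eta> s) + \<phi> * sin (\<theta> s) * sin (\<eta> s)) / \<Delta>)
           has_real_derivative cos (\<theta> s) * sin (\<eta> s)) (at s)"
proof -
  have \<Delta>: "\<Delta> \<noteq> 0" using ne by (simp add: \<Delta>_def)
  have *: "(f has_real_derivative c) (at s)"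
    if "\<And>s. f s = g s / \<Delta>" "(g has_real_derivative c * \<Delta>) (at s)" for f g c
  proof -
    have "f = (\<lambda>s. g s / \<Delta>)" using that(1) by auto
    then show ?thesis using DERIV_cdivide[OF that(2), of \<Delta>] \<Delta> by simp
  qed
  show "((\<lambda>s. (\<psi> * cos (\<theta> s) * sin (\<eta> s) - \<phi> * sin (\<theta> s) * cos (\<eta> s)) / \<Delta>)
           has_real_derivative cos (\<theta> s) * cos (\<eta> s)) (at s)"
    by (rule *, rule refl) (auto intro!: derivative_eq_intros simp: \<Delta>_def power2_eq_square algebra_simps)
  show "((\<lambda>s. (\<phi> * cos (\<theta> s) * sin (\<eta> s) - \<psi> * sin (\<theta> s) * cos (\<eta> s)) / \<Delta>)
           has_real_derivative sin (\<theta> s) * sin (\<eta> s)) (at s)"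
    by (rule *, rule refl) (auto intro!: derivative_eq_intros simp: \<Delta>_def power2_eq_square algebra_simps)
  show "((\<lambda>s. (\<phi> * cos (\<theta> s) * cos (\<eta> s) + \<psi> * sin (\<theta> s) * sin (\<eta> s)) / \<Delta>)
           has_real_derivative sin (\<theta> s) * cos (\<eta> s)) (at s)"
    by (rule *, rule refl) (auto intro!: derivative_eq_intros simp: \<Delta>_def power2_eq_square algebra_simps)
  show "((\<lambda>s. - (\<psi> * cos (\<theta> s) * cos (\<eta> s) + \<phi> * sin (\<theta> s) * sin (\<eta> s)) / \<Delta>)
           has_real_derivative cos (\<theta> s) * sin (\<eta> s)) (at s)"
    by (rule *, rule refl) (auto intro!: derivative_eq_intros simp: \<Delta>_def power2_eq_square algebra_simps)
qed

lemma area_primitive_mixed: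
  "\<exists>F. (\<forall>s. (F has_real_derivative (1/2) * ((cos (\<theta> s) - cos \<phi>) / (2 * \<phi>) * cos (\<eta> s)
        - (sin \<psi> - sin (\<eta> s)) / (2 * \<psi>) * sin (\<theta> s))) (at s)) \<and> F 0 = 0 \<and> F 1 = Z \<phi> \<psi>"
proof (rule primitive_from_0)
  show "((\<lambda>s. (1/2) * (((\<psi> * cos (\<theta> s) * sin (\<eta> s) - \<phi> * sin (\<theta> s) * cos (\<eta> s)) / (2 * (\<phi>\<^sup>2 - \<psi>\<^sup>2))
          - cos \<phi> * (- sin (\<eta> s) / (2 * \<psi>))) / (2 * \<phi>)
        - (sin \<psi> * (cos (\<theta> s) / (2 * \<phi>))
          - (\<phi> * cos (\<theta> s) * sin (\<eta> s) - \<psi> * sin (\<theta> s) * cos (\<eta> s)) / (2 * (\<phi>\<^sup>2 - \<psi>\<^sup>2))) / (2 * \<psi>)))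
      has_real_derivative (1/2) * ((cos (\<theta> s) - cos \<phi>) / (2 * \<phi>) * cos (\<eta> s)
        - (sin \<psi> - sin (\<eta> s)) / (2 * \<psi>) * sin (\<theta> s))) (at s)" (is "(?F has_real_derivative _) _") for s
    by (rule DERIV_cong)
       ((rule product_primitives single_primitives nz DERIV_cmult DERIV_diff DERIV_cdivide)+,
        simp add: field_simps nz)
  have "\<phi>\<^sup>2 - \<psi>\<^sup>2 \<noteq> 0" using ne by simp
  then show "?F 1 - ?F 0 = Z \<phi> \<psi>"
    using nz by (simp add: Z_def divide_simps) (simp add: power2_eq_square algebra_simps)
qed

text \<open>The coefficients of \<open>u\<^sub>1 \<and> u\<^sub>2\<close> and, below, of \<open>v\<^sub>1 \<and> v\<^sub>2\<close> vanish at time 1 because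
  the integrands are odd under the time reversal \<open>s \<mapsto> 1 - s\<close>, in the second case up to two
  terms whose integrals cancel.\<close>

lemma area_primitive_uu:
  "\<exists>F. (\<forall>s. (F has_real_derivative (1/2) * ((cos (\<theta> s) - cos \<phi>) / (2 * \<phi>) * sin (\<eta> s)
        - (cos (\<eta> s) - cos \<psi>) / (2 * \<psi>) * sin (\<theta> s))) (at s)) \<and> F 0 = 0 \<and> F 1 = 0"
proof (rule primitive_from_0)
  show "((\<lambda>s. (1/2) * ((- (\<psi> * cos (\<theta> s) * cos (\<eta> s) + \<phi> * sin (\<theta> s) * sin (\<eta> s)) / (2 * (\<phi>\<^sup>2 - \<psi>\<^sup>2))
          - cos \<phi> * (cos (\<eta> s) / (2 * \<psi>))) / (2 * \<phi>)
        - ((\<phi> * cos (\<theta> s) * cos (\<eta> s) + \<psi> * sin (\<theta> s) * sin (\<eta> s)) / (2 * (\<phi>\<^sup>2 - \<psi>\<^sup>2))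
          - cos \<psi> * (cos (\<theta> s) / (2 * \<phi>))) / (2 * \<psi>)))
      has_real_derivative (1/2) * ((cos (\<theta> s) - cos \<phi>) / (2 * \<phi>) * sin (\<eta> s)
        - (cos (\<eta> s) - cos \<psi>) / (2 * \<psi>) * sin (\<theta> s))) (at s)" (is "(?F has_real_derivative _) _") for s
    by (rule DERIV_cong)
       ((rule product_primitives single_primitives nz DERIV_cmult DERIV_diff DERIV_cdivide)+,
        simp add: field_simps nz)
  show "?F 1 - ?F 0 = 0" by simp
qed

lemma area_primitive_vv:
  "\<exists>F. (\<forall>s. (F has_real_derivative (1/2) * ((sin \<phi> - sin (\<theta> s)) / (2 * \<phi>) * cos (\<eta> s)
        - (sin \<psi> - sin (\<eta> s)) / (2 * \<psi>) * cos (\<theta> s))) (at s)) \<and> F 0 = 0 \<and> F 1 = 0"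
proof (rule primitive_from_0)
  show "((\<lambda>s. (1/2) * ((sin \<phi> * (- sin (\<eta> s) / (2 * \<psi>))
          - (\<phi> * cos (\<theta> s) * cos (\<eta> s) + \<psi> * sin (\<theta> s) * sin (\<eta> s)) / (2 * (\<phi>\<^sup>2 - \<psi>\<^sup>2))) / (2 * \<phi>)
        - (sin \<psi> * (- sin (\<theta> s) / (2 * \<phi>))
          - - (\<psi> * cos (\<theta> s) * cos (\<eta> s) + \<phi> * sin (\<theta> s) * sin (\<eta> s)) / (2 * (\<phi>\<^sup>2 - \<psi>\<^sup>2))) / (2 * \<psi>)))
      has_real_derivative (1/2) * ((sin \<phi> - sin (\<theta> s)) / (2 * \<phi>) * cos (\<eta> s)
        - (sin \<psi> - sin (\<eta> s)) / (2 * \<psi>) * cos (\<theta> s))) (at s)" (is "(?F has_real_derivative _) _") for s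
    by (rule DERIV_cong)
       ((rule product_primitives single_primitives nz DERIV_cmult DERIV_diff DERIV_cdivide)+,
        simp add: field_simps nz)
  show "?F 1 - ?F 0 = 0" using nz by (simp add: field_simps)
qed

end

lemma curve_frame_control:
  assumes nz: "\<phi>1 \<noteq> 0" "\<phi>2 \<noteq> 0" and ne: "\<phi>1\<^sup>2 \<noteq> \<phi>2\<^sup>2"
  shows "curve (frame_control u1 v1 u2 v2 r1 r2 \<phi>1 \<phi>2) 1 = endpoint u1 v1 u2 v2 r1 r2 \<phi>1 \<phi>2"
proof -
  let ?u = "frame_control u1 v1 u2 v2 r1 r2 \<phi>1 \<phi>2"
  note ne' = ne[symmetric]
  obtain F11 where F11: "\<And>s. (F11 has_real_derivative (1/2) *
      ((cos (\<phi>1 * (1 - 2 * s)) - cos \<phi>1) / (2 * \<phi>1) * cos (\<phi>1 * (1 - 2 * s))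
      - (sin \<phi>1 - sin (\<phi>1 * (1 - 2 * s))) / (2 * \<phi>1) * sin (\<phi>1 * (1 - 2 * s)))) (at s)"
      "F11 0 = 0" "F11 1 = U \<phi>1"
    using area_primitive_same[OF nz(1)] by auto
  obtain F22 where F22: "\<And>s. (F22 has_real_derivative (1/2) *
      ((cos (\<phi>2 * (1 - 2 * s)) - cos \<phi>2) / (2 * \<phi>2) * cos (\<phi>2 * (1 - 2 * s))
      - (sin \<phi>2 - sin (\<phi>2 * (1 - 2 * s))) / (2 * \<phi>2) * sin (\<phi>2 * (1 - 2 * s)))) (at s)"
      "F22 0 = 0" "F22 1 = U \<phi>2"
    using area_primitive_same[OF nz(2)] by auto
  obtain F12 where F12: "\<And>s. (F12 has_real_derivative (1/2) *
      ((cos (\<phi>1 * (1 - 2 * s)) - cos \<phi>1) / (2 * \<phi>1) * cos (\<phi>2 * (1 - 2 * s))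
      - (sin \<phi>2 - sin (\<phi>2 * (1 - 2 * s))) / (2 * \<phi>2) * sin (\<phi>1 * (1 - 2 * s)))) (at s)"
      "F12 0 = 0" "F12 1 = Z \<phi>1 \<phi>2"
    using area_primitive_mixed[OF nz ne] by auto
  obtain F21 where F21: "\<And>s. (F21 has_real_derivative (1/2) *
      ((cos (\<phi>2 * (1 - 2 * s)) - cos \<phi>2) / (2 * \<phi>2) * cos (\<phi>1 * (1 - 2 * s))
      - (sin \<phi>1 - sin (\<phi>1 * (1 - 2 * s))) / (2 * \<phi>1) * sin (\<phi>2 * (1 - 2 * s)))) (at s)"
      "F21 0 = 0" "F21 1 = Z \<phi>2 \<phi>1"
    using area_primitive_mixed[OF nz(2,1) ne'] by auto
  obtain Fu where Fu: "\<And>s. (Fu has_real_derivative (1/2) *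
      ((cos (\<phi>1 * (1 - 2 * s)) - cos \<phi>1) / (2 * \<phi>1) * sin (\<phi>2 * (1 - 2 * s))
      - (cos (\<phi>2 * (1 - 2 * s)) - cos \<phi>2) / (2 * \<phi>2) * sin (\<phi>1 * (1 - 2 * s)))) (at s)"
      "Fu 0 = 0" "Fu 1 = 0"
    using area_primitive_uu[OF nz ne] by auto
  obtain Fv where Fv: "\<And>s. (Fv has_real_derivative (1/2) *
      ((sin \<phi>1 - sin (\<phi>1 * (1 - 2 * s))) / (2 * \<phi>1) * cos (\<phi>2 * (1 - 2 * s))
      - (sin \<phi>2 - sin (\<phi>2 * (1 - 2 * s))) / (2 * \<phi>2) * cos (\<phi>1 * (1 - 2 * s)))) (at s)"
      "Fv 0 = 0" "Fv 1 = 0"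
    using area_primitive_vv[OF nz ne] by auto
  define x where "x s =
      (r1 * ((cos (\<phi>1 * (1 - 2 * s)) - cos \<phi>1) / (2 * \<phi>1))) *\<^sub>R u1
    + (r1 * ((sin \<phi>1 - sin (\<phi>1 * (1 - 2 * s))) / (2 * \<phi>1))) *\<^sub>R v1
    + (r2 * ((cos (\<phi>2 * (1 - 2 * s)) - cos \<phi>2) / (2 * \<phi>2))) *\<^sub>R u2
    + (r2 * ((sin \<phi>2 - sin (\<phi>2 * (1 - 2 * s))) / (2 * \<phi>2))) *\<^sub>R v2" for s
  define t where "t s =
      (r1 * r1 * F11 s) *\<^sub>R wedge u1 v1 + (r1 * r2 * F12 s) *\<^sub>R wedge u1 v2
    + (r1 * r2 * F21 s) *\<^sub>R wedge u2 v1 + (r2 * r2 * F22 s) *\<^sub>R wedge u2 v2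
    + (r1 * r2 * Fu s) *\<^sub>R wedge u1 u2 + (r1 * r2 * Fv s) *\<^sub>R wedge v1 v2" for s
  have x: "(x has_vector_derivative ?u s) (at s)" for s
    unfolding x_def[abs_def] frame_control_def
    using nz by (auto intro!: derivative_eq_intros simp: mult_ac)
  have t: "(t has_vector_derivative (1/2) *\<^sub>R wedge (x s) (?u s)) (at s)" for s
  proof -
    have lin: "((\<lambda>s. (r * F s) *\<^sub>R A) has_vector_derivative (r * f) *\<^sub>R A) (at s)"
      if "(F has_real_derivative f) (at s)" for F f r and A :: "real^4^4"
      using that by (auto intro!: derivative_eq_intros)
    show ?thesis
      unfolding t_def[abs_def] x_def frame_control_def wedge_frame_combination scaleR_add_right scaleR_scaleR
      by (rule has_vector_derivative_eq_rhs,
          (rule has_vector_derivative_add lin F11 F12 F21 F22 Fu Fv)+)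
         (simp add: algebra_simps)
  qed
  have "x 0 = 0" "t 0 = 0" by (simp_all add: x_def t_def F11 F12 F21 F22 Fu Fv)
  then have "is_curve ?u (\<lambda>s. (x s, t s))"
    unfolding is_curve_def by (auto intro!: has_vector_derivative_Pair x t)
  moreover have "continuous_on UNIV ?u"
    unfolding frame_control_def[abs_def] by (intro continuous_intros)
  ultimately have "curve ?u = (\<lambda>s. (x s, t s))" by (intro curve_eqI)
  moreover have "x 1 = fst (endpoint u1 v1 u2 v2 r1 r2 \<phi>1 \<phi>2)"
    using nz by (simp add: x_def endpoint_def T_def)
  moreover have "t 1 = snd (endpoint u1 v1 u2 v2 r1 r2 \<phi>1 \<phi>2)"
    by (simp add: t_def endpoint_def F11 F12 F21 F22 Fu Fv power2_eq_square)
  ultimately show ?thesis by simp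
qed

lemma sR_exp_covector:
  assumes "orthonormal4 u1 v1 u2 v2" "\<phi>1 \<noteq> 0" "\<phi>2 \<noteq> 0" "\<phi>1\<^sup>2 \<noteq> \<phi>2\<^sup>2"
  shows "sR_exp (covector u1 v1 u2 v2 r1 r2 \<phi>1 \<phi>2) = endpoint u1 v1 u2 v2 r1 r2 \<phi>1 \<phi>2"
proof -
  obtain \<xi> \<tau> where *: "(\<xi>, \<tau>) = covector u1 v1 u2 v2 r1 r2 \<phi>1 \<phi>2" by (metis surj_pair)
  show ?thesis
    unfolding *[symmetric]
    by (simp add: sR_exp_def covector_control_frame[OF assms(1) *] curve_frame_control assms)
qed

section \<open>Variation of frame, radii and angles\<close>

lemma has_real_derivative_T:
  assumes "(f has_real_derivative f') (at a)" "f a \<noteq> 0"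
  shows "((\<lambda>s. T (f s)) has_real_derivative - 2 * V (f a) * f') (at a)"
  unfolding T_def V_def using assms
  by (auto intro!: derivative_eq_intros simp: field_simps power2_eq_square)

lemma has_real_derivative_U:
  assumes "(f has_real_derivative f') (at a)" "f a \<noteq> 0"
  shows "((\<lambda>s. U (f s)) has_real_derivative cos (f a) / f a * V (f a) * f') (at a)"
proof -
  define x where "x = f a"
  have sq: "sin t * sin t = 1 - cos t * cos t" for t :: real
    using sin_cos_squared_add[of t] by (simp add: power2_eq_square)
  have num: "((\<lambda>s. f s - sin (f s) * cos (f s)) has_real_derivative 2 * (1 - cos x * cos x) * f') (at a)"
    by (auto intro!: derivative_eq_intros assms simp: x_def[symmetric] sq algebra_simps)
  have den: "((\<lambda>s. 4 * (f s)\<^sup>2) has_real_derivative 8 * x * f') (at a)"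
    by (auto intro!: derivative_eq_intros assms simp: x_def[symmetric] algebra_simps)
  have x: "x \<noteq> 0" "4 * (f a)\<^sup>2 \<noteq> 0" using assms(2) by (simp_all add: x_def)
  show ?thesis
    unfolding U_def V_def
    by (rule DERIV_cong[OF DERIV_divide[OF num den x(2)]])
       (use x(1) in \<open>simp add: x_def[symmetric] field_simps power2_eq_square\<close>)
qed

text \<open>The quotient rule gives some coefficients for the two inner derivatives. Specialising one inner
  function to a constant identifies them with the partial derivatives.\<close>

lemma has_real_derivative_Z:
  assumes f: "(f has_real_derivative f') (at a)" and g: "(g has_real_derivative g') (at a)"
    and nz: "g a \<noteq> 0" and ne: "(f a)\<^sup>2 \<noteq> (g a)\<^sup>2"
  shows "((\<lambda>s. Z (f s) (g s)) has_real_derivative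
      partial1 Z (f a) (g a) * f' + partial2 Z (f a) (g a) * g') (at a)"
proof -
  define N1 where "N1 x y = y * cos y * cos x - cos x * sin y + x * sin x * sin y" for x y :: real
  define N2 where "N2 x y = cos y * sin x - y * sin y * sin x - x * cos x * cos y" for x y :: real
  define N where "N x y = y * cos y * sin x - x * cos x * sin y" for x y :: real
  define E where "E x y = 2 * y * (x\<^sup>2 - y\<^sup>2)" for x y :: real
  define Z1 where "Z1 x y = (N1 x y * E x y - N x y * (4 * x * y)) / (E x y * E x y)" for x y
  define Z2 where "Z2 x y = (N2 x y * E x y - N x y * (2 * (x\<^sup>2 - y\<^sup>2) - 4 * y\<^sup>2)) / (E x y * E x y)" for x y
  have chain: "((\<lambda>s. Z (f s) (g s)) has_real_derivative Z1 (f a) (g a) * f' + Z2 (f a) (g a) * g') (at a)"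
    if f: "(f has_real_derivative f') (at a)" and g: "(g has_real_derivative g') (at a)"
      and nz: "g a \<noteq> 0" and ne: "(f a)\<^sup>2 \<noteq> (g a)\<^sup>2" for f g f' g' a
  proof -
    have N: "((\<lambda>s. N (f s) (g s)) has_real_derivative N1 (f a) (g a) * f' + N2 (f a) (g a) * g') (at a)"
      unfolding N_def N1_def N2_def
      by (auto intro!: derivative_eq_intros f g simp: algebra_simps)
    have E: "((\<lambda>s. E (f s) (g s)) has_real_derivative
        4 * f a * g a * f' + (2 * ((f a)\<^sup>2 - (g a)\<^sup>2) - 4 * (g a)\<^sup>2) * g') (at a)"
      unfolding E_def
      by (auto intro!: derivative_eq_intros f g simp: algebra_simps power2_eq_square)
    have nz: "E (f a) (g a) \<noteq> 0" using nz ne by (simp add: E_def)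
    have "Z (f s) (g s) = N (f s) (g s) / E (f s) (g s)" for s by (simp add: Z_def N_def E_def)
    then show ?thesis
      using DERIV_cong[OF DERIV_divide[OF N E nz], of "Z1 (f a) (g a) * f' + Z2 (f a) (g a) * g'"]
      by (simp add: Z1_def Z2_def add_divide_distrib[symmetric] algebra_simps)
  qed
  have "partial1 Z (f a) (g a) = Z1 (f a) (g a)"
    unfolding partial1_def
    using chain[where f = "\<lambda>s. s" and f' = 1 and g = "\<lambda>_. g a" and g' = 0 and a = "f a"] nz ne
    by (auto intro!: DERIV_imp_deriv)
  moreover have "partial2 Z (f a) (g a) = Z2 (f a) (g a)"
    unfolding partial2_def
    using chain[where f = "\<lambda>_. f a" and f' = 0 and g = "\<lambda>s. s" and g' = 1 and a = "g a"] nz ne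
    by (auto intro!: DERIV_imp_deriv)
  ultimately show ?thesis using chain[OF f g nz ne] by simp
qed

text \<open>A skew generator moves a frame through orthonormal frames. The motion \<open>e\<^sup>s\<^sup>X w\<close> is itself a
  control with covector \<open>(w, - X)\<close>, so its properties are already known.\<close>

lemma rotating_frame:
  assumes X: "X \<in> so4" and on: "orthonormal4 u1 v1 u2 v2"
  defines "e \<equiv> \<lambda>w. covector_control w (- X)"
  shows "e w 0 = w" "(e w has_vector_derivative X *v e w s) (at s)"
    "orthonormal4 (e u1 s) (e v1 s) (e u2 s) (e v2 s)"
proof -
  show 0: "e w 0 = w" for w by (simp add: e_def covector_control_ode)
  show d: "(e w has_vector_derivative X *v e w s) (at s)" for w s
    using covector_control_ode(2)[of w "- X" s] by (simp add: e_def mvec.minus_left)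
  have "((\<lambda>s. e w s \<bullet> e z s) has_vector_derivative 0) (at s)" for w z s
    using bounded_bilinear.has_vector_derivative[OF bounded_bilinear_inner d[of w s] d[of z s]]
      so4_inner_skew[OF X, of "e w s" "e z s"] by (simp add: inner_commute)
  then have "(\<lambda>s. e w s \<bullet> e z s) = (\<lambda>_. w \<bullet> z)" for w z
    by (rule has_vector_derivative_unique_from_0) (simp_all add: 0)
  then show "orthonormal4 (e u1 s) (e v1 s) (e u2 s) (e v2 s)"
    using on by (simp add: orthonormal4_def fun_eq_iff)
qed

text \<open>The derivatives of \<open>a \<and> b\<close>, of the covector and of the endpoint when the frame moves with
  generator \<open>X\<close> and the radii and angles with velocities \<open>\<rho>1, \<rho>2\<close> and
  \<open>\<psi>1, \<psi>2\<close>.\<close>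

definition wedge_variation :: "real^4^4 \<Rightarrow> real^4 \<Rightarrow> real^4 \<Rightarrow> real^4^4" where
  "wedge_variation X a b = wedge (X *v a) b + wedge a (X *v b)"

definition covector_variation where
  "covector_variation u1 v1 u2 v2 r1 r2 \<phi>1 \<phi>2 X \<rho>1 \<rho>2 \<psi>1 \<psi>2 =
     ((\<rho>1 * sin \<phi>1 + r1 * cos \<phi>1 * \<psi>1) *\<^sub>R u1 + (r1 * sin \<phi>1) *\<^sub>R (X *v u1)
    + (\<rho>1 * cos \<phi>1 - r1 * sin \<phi>1 * \<psi>1) *\<^sub>R v1 + (r1 * cos \<phi>1) *\<^sub>R (X *v v1)
    + (\<rho>2 * sin \<phi>2 + r2 * cos \<phi>2 * \<psi>2) *\<^sub>R u2 + (r2 * sin \<phi>2) *\<^sub>R (X *v u2)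
    + (\<rho>2 * cos \<phi>2 - r2 * sin \<phi>2 * \<psi>2) *\<^sub>R v2 + (r2 * cos \<phi>2) *\<^sub>R (X *v v2),
      (2 * \<psi>1) *\<^sub>R wedge u1 v1 + (2 * \<phi>1) *\<^sub>R wedge_variation X u1 v1
    + (2 * \<psi>2) *\<^sub>R wedge u2 v2 + (2 * \<phi>2) *\<^sub>R wedge_variation X u2 v2)"

definition endpoint_variation where
  "endpoint_variation u1 v1 u2 v2 r1 r2 \<phi>1 \<phi>2 X \<rho>1 \<rho>2 \<psi>1 \<psi>2 =
     ((\<rho>1 * T \<phi>1 - 2 * r1 * V \<phi>1 * \<psi>1) *\<^sub>R v1 + (r1 * T \<phi>1) *\<^sub>R (X *v v1)
    + (\<rho>2 * T \<phi>2 - 2 * r2 * V \<phi>2 * \<psi>2) *\<^sub>R v2 + (r2 * T \<phi>2) *\<^sub>R (X *v v2),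
      (2 * r1 * \<rho>1 * U \<phi>1 + r1\<^sup>2 * (cos \<phi>1 / \<phi>1 * V \<phi>1 * \<psi>1)) *\<^sub>R wedge u1 v1
    + (r1\<^sup>2 * U \<phi>1) *\<^sub>R wedge_variation X u1 v1
    + ((\<rho>1 * r2 + r1 * \<rho>2) * Z \<phi>1 \<phi>2
        + r1 * r2 * (partial1 Z \<phi>1 \<phi>2 * \<psi>1 + partial2 Z \<phi>1 \<phi>2 * \<psi>2)) *\<^sub>R wedge u1 v2
    + (r1 * r2 * Z \<phi>1 \<phi>2) *\<^sub>R wedge_variation X u1 v2
    + ((\<rho>1 * r2 + r1 * \<rho>2) * Z \<phi>2 \<phi>1
        + r1 * r2 * (partial1 Z \<phi>2 \<phi>1 * \<psi>2 + partial2 Z \<phi>2 \<phi>1 * \<psi>1)) *\<^sub>R wedge u2 v1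
    + (r1 * r2 * Z \<phi>2 \<phi>1) *\<^sub>R wedge_variation X u2 v1
    + (2 * r2 * \<rho>2 * U \<phi>2 + r2\<^sup>2 * (cos \<phi>2 / \<phi>2 * V \<phi>2 * \<psi>2)) *\<^sub>R wedge u2 v2
    + (r2\<^sup>2 * U \<phi>2) *\<^sub>R wedge_variation X u2 v2)"

lemma has_vector_derivative_wedge_frame:
  assumes "(f has_real_derivative f') (at a)"
    and "(p has_vector_derivative X *v p a) (at a)" "(q has_vector_derivative X *v q a) (at a)"
  shows "((\<lambda>s. f s *\<^sub>R wedge (p s) (q s)) has_vector_derivative
      f' *\<^sub>R wedge (p a) (q a) + f a *\<^sub>R wedge_variation X (p a) (q a)) (at a)"
  using has_vector_derivative_scaleR[OF assms(1) wedge.has_vector_derivative[OF assms(2,3)]]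
  by (simp add: wedge_variation_def algebra_simps)

lemma has_vector_derivative_vec_frame:
  assumes "(f has_real_derivative f') (at a)" and "(p has_vector_derivative X *v p a) (at a)"
  shows "((\<lambda>s. f s *\<^sub>R p s) has_vector_derivative f' *\<^sub>R p a + f a *\<^sub>R (X *v p a)) (at a)"
  using has_vector_derivative_scaleR[OF assms] by (simp add: add.commute)

text \<open>Any differential takes these values: along the moving parameters the exponential coincides with the
  explicit endpoint for small times.\<close>

lemma derivative_along_variation:
  assumes D: "(sR_exp has_derivative D) (at (covector u1 v1 u2 v2 r1 r2 \<phi>1 \<phi>2) within UNIV \<times> so4)"
    and on: "orthonormal4 u1 v1 u2 v2" and X: "X \<in> so4"
    and \<phi>: "\<phi>1 \<noteq> 0" "\<phi>2 \<noteq> 0" "\<phi>1\<^sup>2 \<noteq> \<phi>2\<^sup>2"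
  shows "D (covector_variation u1 v1 u2 v2 r1 r2 \<phi>1 \<phi>2 X \<rho>1 \<rho>2 \<psi>1 \<psi>2)
       = endpoint_variation u1 v1 u2 v2 r1 r2 \<phi>1 \<phi>2 X \<rho>1 \<rho>2 \<psi>1 \<psi>2"
proof -
  define e where "e w = covector_control w (- X)" for w
  note e = rotating_frame[OF X on, folded e_def]
  define R1 where "R1 s = r1 + \<rho>1 * s" for s
  define R2 where "R2 s = r2 + \<rho>2 * s" for s
  define P1 where "P1 s = \<phi>1 + \<psi>1 * s" for s
  define P2 where "P2 s = \<phi>2 + \<psi>2 * s" for s
  have at0: "R1 0 = r1" "R2 0 = r2" "P1 0 = \<phi>1" "P2 0 = \<phi>2"
    by (simp_all add: R1_def R2_def P1_def P2_def)
  have d: "(R1 has_real_derivative \<rho>1) (at 0)" "(R2 has_real_derivative \<rho>2) (at 0)"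
    "(P1 has_real_derivative \<psi>1) (at 0)" "(P2 has_real_derivative \<psi>2) (at 0)"
    unfolding R1_def[abs_def] R2_def[abs_def] P1_def[abs_def] P2_def[abs_def]
    by (auto intro!: derivative_eq_intros)
  define c where "c s = covector (e u1 s) (e v1 s) (e u2 s) (e v2 s) (R1 s) (R2 s) (P1 s) (P2 s)" for s
  define p where "p s = endpoint (e u1 s) (e v1 s) (e u2 s) (e v2 s) (R1 s) (R2 s) (P1 s) (P2 s)" for s
  have ev: "(e w has_vector_derivative X *v e w 0) (at 0)" for w
    by (rule e(2))
  have c: "(c has_vector_derivative covector_variation u1 v1 u2 v2 r1 r2 \<phi>1 \<phi>2 X \<rho>1 \<rho>2 \<psi>1 \<psi>2) (at 0)"
    unfolding c_def[abs_def] covector_def covector_variation_def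
    apply (intro has_vector_derivative_Pair)
     apply (rule has_vector_derivative_eq_rhs)
      apply (rule has_vector_derivative_add has_vector_derivative_vec_frame ev
         derivative_eq_intros d refl)+
     apply (simp add: e(1) at0 algebra_simps)
     apply (rule has_vector_derivative_eq_rhs)
      apply (rule has_vector_derivative_add has_vector_derivative_wedge_frame ev
         derivative_eq_intros d refl)+
     apply (simp add: e(1) at0 algebra_simps)
    done
  have nz: "P1 0 \<noteq> 0" "P2 0 \<noteq> 0" "(P1 0)\<^sup>2 \<noteq> (P2 0)\<^sup>2" "(P2 0)\<^sup>2 \<noteq> (P1 0)\<^sup>2"
    using \<phi> by (simp_all add: at0)
  have p: "(p has_vector_derivative endpoint_variation u1 v1 u2 v2 r1 r2 \<phi>1 \<phi>2 X \<rho>1 \<rho>2 \<psi>1 \<psi>2) (at 0)"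
    unfolding p_def[abs_def] endpoint_def endpoint_variation_def
    apply (intro has_vector_derivative_Pair)
     apply (rule has_vector_derivative_eq_rhs)
      apply (rule has_vector_derivative_add has_vector_derivative_vec_frame ev
         DERIV_mult has_real_derivative_T d nz refl)+
     apply (simp add: e(1) at0 algebra_simps)
     apply (rule has_vector_derivative_eq_rhs)
      apply (rule has_vector_derivative_add has_vector_derivative_wedge_frame ev
         DERIV_mult has_real_derivative_U has_real_derivative_Z DERIV_power d nz refl)+
     apply (simp add: e(1) at0 algebra_simps)
    done
  have cS: "range c \<subseteq> UNIV \<times> so4"
    by (intro image_subsetI) (simp add: c_def mem_Times_iff snd_covector_in_so4)
  have c0: "c 0 = covector u1 v1 u2 v2 r1 r2 \<phi>1 \<phi>2"
    by (simp add: c_def e(1) at0)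
  have "((sR_exp \<circ> c) has_vector_derivative
      D (covector_variation u1 v1 u2 v2 r1 r2 \<phi>1 \<phi>2 X \<rho>1 \<rho>2 \<psi>1 \<psi>2)) (at 0)"
    by (rule vector_derivative_diff_chain_within[OF c])
       (use has_derivative_subset[OF D cS] in \<open>simp add: c0\<close>)
  moreover have "((sR_exp \<circ> c) has_vector_derivative
      endpoint_variation u1 v1 u2 v2 r1 r2 \<phi>1 \<phi>2 X \<rho>1 \<rho>2 \<psi>1 \<psi>2) (at 0)"
  proof (rule has_vector_derivative_transform_within_open[OF p])
    let ?S = "{s. P1 s \<noteq> 0} \<inter> {s. P2 s \<noteq> 0} \<inter> {s. (P1 s)\<^sup>2 \<noteq> (P2 s)\<^sup>2}"
    show "open ?S"
      unfolding P1_def P2_def by (intro open_Int open_Collect_neq continuous_intros)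
    show "0 \<in> ?S" using nz by simp
    show "p s = (sR_exp \<circ> c) s" if "s \<in> ?S" for s
      using that by (simp add: p_def c_def sR_exp_covector[OF e(3)])
  qed
  ultimately show ?thesis by (rule vector_derivative_unique_at)
qed

section \<open>The differential in coordinates\<close>

lemma exhaust_6: "x = 1 \<or> x = 2 \<or> x = 3 \<or> x = 4 \<or> x = 5 \<or> x = (6::6)"
proof (induct x)
  case (of_int z)
  then have "z = 0 \<or> z = 1 \<or> z = 2 \<or> z = 3 \<or> z = 4 \<or> z = 5" by fastforce
  then show ?case by auto
qed

lemma UNIV_6: "UNIV = {1, 2, 3, 4, 5, 6::6}"
  using exhaust_6 by auto

lemma forall_6: "(\<forall>i::6. P i) \<longleftrightarrow> P 1 \<and> P 2 \<and> P 3 \<and> P 4 \<and> P 5 \<and> P 6"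
  by (metis exhaust_6)

lemma sum_6: "sum f (UNIV::6 set) = f 1 + f 2 + f 3 + f 4 + f 5 + f 6"
  unfolding UNIV_6 by (simp add: ac_simps)

lemma vector_4:
  "(vector [a, b, c, d] :: 'a::zero^4) $ 1 = a" "(vector [a, b, c, d] :: 'a^4) $ 2 = b"
  "(vector [a, b, c, d] :: 'a^4) $ 3 = c" "(vector [a, b, c, d] :: 'a^4) $ 4 = d"
  unfolding vector_def by simp_all

lemma vector_6:
  "(vector [a, b, c, d, e, f] :: 'a::zero^6) $ 1 = a" "(vector [a, b, c, d, e, f] :: 'a^6) $ 2 = b"
  "(vector [a, b, c, d, e, f] :: 'a^6) $ 3 = c" "(vector [a, b, c, d, e, f] :: 'a^6) $ 4 = d"
  "(vector [a, b, c, d, e, f] :: 'a^6) $ 5 = e" "(vector [a, b, c, d, e, f] :: 'a^6) $ 6 = f"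
  unfolding vector_def by simp_all

text \<open>The infinitesimal rotations, split by parity: \<open>x\<close> holds those that mix a \<open>u\<close> with a
  \<open>v\<close>, and \<open>y$1, y$2\<close> those that do not. The factor \<open>c\<close>, later \<open>r1 * r2\<close>, is
  the scaling under which the columns of \<open>M\<^sub>1\<close> and \<open>M\<^sub>2\<close> appear. The sign gives
  \<open>x$1\<close> the effect \<open>u1 \<mapsto> v1, v1 \<mapsto> - u1\<close>.\<close>

definition generator :: "real^4 \<Rightarrow> real^4 \<Rightarrow> real^4 \<Rightarrow> real^4 \<Rightarrow> real \<Rightarrow> real^4 \<Rightarrow> real^6 \<Rightarrow> real^4^4" where
  "generator u1 v1 u2 v2 c x y =
     - (x$1 *\<^sub>R wedge u1 v1 + x$2 *\<^sub>R wedge u2 v2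
      + (c * x$3) *\<^sub>R wedge u1 v2 + (c * x$4) *\<^sub>R wedge u2 v1
      + (c * y$1) *\<^sub>R wedge u1 u2 + (c * y$2) *\<^sub>R wedge v1 v2)"

text \<open>Coordinates on the source: besides the rotations, \<open>y$3, y$4\<close> are the relative variations of the
  radii, and \<open>y$5, y$6\<close> the variations of the angles.\<close>

definition covector_coords :: "real^4 \<Rightarrow> real^4 \<Rightarrow> real^4 \<Rightarrow> real^4 \<Rightarrow>
    real \<Rightarrow> real \<Rightarrow> real \<Rightarrow> real \<Rightarrow> (real^4) \<times> (real^6) \<Rightarrow> (real^4) \<times> (real^4^4)" where
  "covector_coords u1 v1 u2 v2 r1 r2 \<phi>1 \<phi>2 = (\<lambda>(x, y).
     covector_variation u1 v1 u2 v2 r1 r2 \<phi>1 \<phi>2 (generator u1 v1 u2 v2 (r1 * r2) x y)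
       (r1 * y$3) (r2 * y$4) (y$5) (y$6))"

text \<open>Coordinates on the target, in the order and with the scaling of the rows of \<open>M\<^sub>1\<close> (for
  \<open>x\<close>) and \<open>M\<^sub>2\<close> (for \<open>y\<close>). The fifth row of \<open>M\<^sub>2\<close> carries a minus sign.\<close>

definition endpoint_coords :: "real^4 \<Rightarrow> real^4 \<Rightarrow> real^4 \<Rightarrow> real^4 \<Rightarrow> 
    real \<Rightarrow> real \<Rightarrow> (real^4) \<times> (real^6) \<Rightarrow> point" where
  "endpoint_coords u1 v1 u2 v2 r1 r2 = (\<lambda>(x, y).
     ((r1 * x$1) *\<^sub>R u1 + (r1 * y$1) *\<^sub>R v1 + (r2 * x$2) *\<^sub>R u2 + (r2 * y$2) *\<^sub>R v2,
      (r1\<^sup>2 * y$3) *\<^sub>R wedge u1 v1 + (r1 * r2 * y$4) *\<^sub>R wedge u1 v2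
    + (- (r1 * r2 * y$5)) *\<^sub>R wedge u2 v1 + (r2\<^sup>2 * y$6) *\<^sub>R wedge u2 v2
    + (r1 * r2 * x$3) *\<^sub>R wedge u1 u2 + (r1 * r2 * x$4) *\<^sub>R wedge v1 v2))"

lemma generator_in_so4: "generator u1 v1 u2 v2 c x y \<in> so4"
  unfolding generator_def
  by (intro subspace_neg subspace_add subspace_scale subspace_so4 wedge_in_so4)

lemma generator_mult_vec:
  assumes "orthonormal4 u1 v1 u2 v2"
  shows "generator u1 v1 u2 v2 c x y *v u1 = x$1 *\<^sub>R v1 + (c * y$1) *\<^sub>R u2 + (c * x$3) *\<^sub>R v2"
    and "generator u1 v1 u2 v2 c x y *v v1 = (- x$1) *\<^sub>R u1 + (- (c * x$4)) *\<^sub>R u2 + (c * y$2) *\<^sub>R v2"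
    and "generator u1 v1 u2 v2 c x y *v u2 = (- (c * y$1)) *\<^sub>R u1 + (c * x$4) *\<^sub>R v1 + x$2 *\<^sub>R v2"
    and "generator u1 v1 u2 v2 c x y *v v2 = (- (c * x$3)) *\<^sub>R u1 + (- (c * y$2)) *\<^sub>R v1 + (- x$2) *\<^sub>R u2"
  unfolding generator_def
  by (simp_all add: mvec.add_left mvec.diff_left mvec.minus_left mvec.scaleR_left wedge_mult_vec
      orthonormal4_inner[OF assms])

lemma wedge_antisym: "wedge b a = - wedge a b"
  by (simp add: wedge_def vec_eq_iff)

lemma wedge_self: "wedge a a = 0"
  by (simp add: wedge_def vec_eq_iff)

lemma covector_coords_eq:
  assumes "orthonormal4 u1 v1 u2 v2"
  shows "covector_coords u1 v1 u2 v2 r1 r2 \<phi>1 \<phi>2 (x, y) =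
    ((r1 * (y$3 * sin \<phi>1 + cos \<phi>1 * (y$5 - x$1) - r2 * (r2 * (sin \<phi>2 * y$1 + cos \<phi>2 * x$3)))) *\<^sub>R u1
   + (r1 * (y$3 * cos \<phi>1 - sin \<phi>1 * (y$5 - x$1) + r2 * (r2 * (sin \<phi>2 * x$4 - cos \<phi>2 * y$2)))) *\<^sub>R v1
   + (r2 * (y$4 * sin \<phi>2 + cos \<phi>2 * (y$6 - x$2) + r1 * (r1 * (sin \<phi>1 * y$1 - cos \<phi>1 * x$4)))) *\<^sub>R u2
   + (r2 * (y$4 * cos \<phi>2 - sin \<phi>2 * (y$6 - x$2) + r1 * (r1 * (sin \<phi>1 * x$3 + cos \<phi>1 * y$2)))) *\<^sub>R v2,
     (2 * y$5) *\<^sub>R wedge u1 v1 + (2 * r1 * r2 * (\<phi>1 * y$2 - \<phi>2 * y$1)) *\<^sub>R wedge u1 v2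
   + (2 * r1 * r2 * (\<phi>1 * y$1 - \<phi>2 * y$2)) *\<^sub>R wedge u2 v1 + (2 * y$6) *\<^sub>R wedge u2 v2
   + (2 * r1 * r2 * (\<phi>2 * x$3 - \<phi>1 * x$4)) *\<^sub>R wedge u1 u2
   + (2 * r1 * r2 * (\<phi>2 * x$4 - \<phi>1 * x$3)) *\<^sub>R wedge v1 v2)"
  by (simp add: covector_coords_def covector_variation_def wedge_variation_def generator_mult_vec[OF assms]
      wedge.add_left wedge.add_right wedge.diff_left wedge.diff_right wedge.scaleR_left wedge.scaleR_right wedge.minus_left wedge.minus_right
      wedge_self wedge_antisym[of v1 u1] wedge_antisym[of u2 u1] wedge_antisym[of v2 u1]
      wedge_antisym[of v2 v1] wedge_antisym[of v1 u2] wedge_antisym[of v2 u2] algebra_simps)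

lemma M1_mult_vec:
  "(M1 r1 r2 \<phi>1 \<phi>2 *v x) $ 1 = - T \<phi>1 * x$1 - r2\<^sup>2 * T \<phi>2 * x$3"
  "(M1 r1 r2 \<phi>1 \<phi>2 *v x) $ 2 = - T \<phi>2 * x$2 - r1\<^sup>2 * T \<phi>1 * x$4"
  "(M1 r1 r2 \<phi>1 \<phi>2 *v x) $ 3 =
     Z \<phi>2 \<phi>1 * x$1 - Z \<phi>1 \<phi>2 * x$2 + r2\<^sup>2 * U \<phi>2 * x$3 - r1\<^sup>2 * U \<phi>1 * x$4"
  "(M1 r1 r2 \<phi>1 \<phi>2 *v x) $ 4 =
     Z \<phi>1 \<phi>2 * x$1 - Z \<phi>2 \<phi>1 * x$2 - r1\<^sup>2 * U \<phi>1 * x$3 + r2\<^sup>2 * U \<phi>2 * x$4"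
  by (simp_all add: M1_def matrix_vector_mult_def sum_4 vector_4)

lemma M2_mult_vec:
  "(M2 r1 r2 \<phi>1 \<phi>2 *v y) $ 1 = - r2\<^sup>2 * T \<phi>2 * y$2 + T \<phi>1 * y$3 - 2 * V \<phi>1 * y$5"
  "(M2 r1 r2 \<phi>1 \<phi>2 *v y) $ 2 = r1\<^sup>2 * T \<phi>1 * y$2 + T \<phi>2 * y$4 - 2 * V \<phi>2 * y$6"
  "(M2 r1 r2 \<phi>1 \<phi>2 *v y) $ 3 = - r2\<^sup>2 * Z \<phi>2 \<phi>1 * y$1 - r2\<^sup>2 * Z \<phi>1 \<phi>2 * y$2
     + 2 * U \<phi>1 * y$3 + cos \<phi>1 / \<phi>1 * V \<phi>1 * y$5"
  "(M2 r1 r2 \<phi>1 \<phi>2 *v y) $ 4 = - r2\<^sup>2 * U \<phi>2 * y$1 + r1\<^sup>2 * U \<phi>1 * y$2 + Z \<phi>1 \<phi>2 * y$3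
     + Z \<phi>1 \<phi>2 * y$4 + partial1 Z \<phi>1 \<phi>2 * y$5 + partial2 Z \<phi>1 \<phi>2 * y$6"
  "(M2 r1 r2 \<phi>1 \<phi>2 *v y) $ 5 = - r1\<^sup>2 * U \<phi>1 * y$1 + r2\<^sup>2 * U \<phi>2 * y$2 - Z \<phi>2 \<phi>1 * y$3
     - Z \<phi>2 \<phi>1 * y$4 - partial2 Z \<phi>2 \<phi>1 * y$5 - partial1 Z \<phi>2 \<phi>1 * y$6"
  "(M2 r1 r2 \<phi>1 \<phi>2 *v y) $ 6 = r1\<^sup>2 * Z \<phi>1 \<phi>2 * y$1 + r1\<^sup>2 * Z \<phi>2 \<phi>1 * y$2
     + 2 * U \<phi>2 * y$4 + cos \<phi>2 / \<phi>2 * V \<phi>2 * y$6"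
  by (simp_all add: M2_def matrix_vector_mult_def sum_6 vector_6)

text \<open>The block decomposition: in these coordinates the variation of the endpoint is multiplication by
  \<open>M\<^sub>1\<close> and \<open>M\<^sub>2\<close>.\<close>

lemma endpoint_variation_coords:
  assumes "orthonormal4 u1 v1 u2 v2"
  shows "endpoint_variation u1 v1 u2 v2 r1 r2 \<phi>1 \<phi>2 (generator u1 v1 u2 v2 (r1 * r2) x y)
       (r1 * y$3) (r2 * y$4) (y$5) (y$6)
     = endpoint_coords u1 v1 u2 v2 r1 r2 (M1 r1 r2 \<phi>1 \<phi>2 *v x, M2 r1 r2 \<phi>1 \<phi>2 *v y)"
  by (simp add: endpoint_coords_def endpoint_variation_def wedge_variation_def generator_mult_vec[OF assms]
      M1_mult_vec M2_mult_vec power2_eq_square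
      wedge.add_left wedge.add_right wedge.diff_left wedge.diff_right wedge.scaleR_left wedge.scaleR_right wedge.minus_left wedge.minus_right
      wedge_self wedge_antisym[of v1 u1] wedge_antisym[of u2 u1] wedge_antisym[of v2 u1]
      wedge_antisym[of v2 v1] wedge_antisym[of v1 u2] wedge_antisym[of v2 u2] algebra_simps)

lemma frame_vector_eq_0:
  assumes "orthonormal4 u1 v1 u2 v2"
    and "a *\<^sub>R u1 + b *\<^sub>R v1 + c *\<^sub>R u2 + d *\<^sub>R v2 = 0"
  shows "a = 0" "b = 0" "c = 0" "d = 0"
proof -
  have ip: "e \<bullet> (a *\<^sub>R u1 + b *\<^sub>R v1 + c *\<^sub>R u2 + d *\<^sub>R v2) = 0" for e
    unfolding assms(2) by simp
  show "a = 0" "b = 0" "c = 0" "d = 0"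
    using ip[of u1] ip[of v1] ip[of u2] ip[of v2]
    by (simp_all add: inner_add_right orthonormal4_inner[OF assms(1)])
qed

lemma frame_bivector_eq_0:
  assumes "orthonormal4 u1 v1 u2 v2"
    and "a *\<^sub>R wedge u1 v1 + b *\<^sub>R wedge u1 v2 + c *\<^sub>R wedge u2 v1 + d *\<^sub>R wedge u2 v2
       + e *\<^sub>R wedge u1 u2 + f *\<^sub>R wedge v1 v2 = 0" (is "?B = 0")
  shows "a = 0" "b = 0" "c = 0" "d = 0" "e = 0" "f = 0"
proof -
  have "p \<bullet> (?B *v q) = 0" for p q
    unfolding assms(2) by (simp add: mvec.zero_left)
  from this[of u1 v1] this[of u1 v2] this[of u2 v1] this[of u2 v2] this[of u1 u2] this[of v1 v2]
  show "a = 0" "b = 0" "c = 0" "d = 0" "e = 0" "f = 0"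
    by (simp_all add: mvec.add_left mvec.scaleR_left wedge_mult_vec inner_add_right inner_diff_right
        orthonormal4_inner[OF assms(1)])
qed

lemma frame_expansion:
  assumes on: "orthonormal4 u1 v1 u2 v2" and span: "span {u1, v1, u2, v2} = UNIV"
  shows "z = (z \<bullet> u1) *\<^sub>R u1 + (z \<bullet> v1) *\<^sub>R v1 + (z \<bullet> u2) *\<^sub>R u2 + (z \<bullet> v2) *\<^sub>R v2" (is "z = ?s")
proof -
  have "orthogonal (z - ?s) w" if "w \<in> span {u1, v1, u2, v2}" for w
    using that
  proof (rule orthogonal_to_span)
    fix w assume "w \<in> {u1, v1, u2, v2}"
    then show "orthogonal (z - ?s) w"
      by (auto simp: orthogonal_def inner_diff_left inner_add_left orthonormal4_inner[OF on])
  qed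
  then have "orthogonal (z - ?s) (z - ?s)" by (simp add: span)
  then show ?thesis by (simp add: orthogonal_self)
qed

text \<open>A skew form is determined by its values on the six pairs of frame vectors.\<close>

lemma so4_frame_expansion:
  assumes on: "orthonormal4 u1 v1 u2 v2" and span: "span {u1, v1, u2, v2} = UNIV" and A: "A \<in> so4"
  shows "A = (u1 \<bullet> (A *v v1)) *\<^sub>R wedge u1 v1 + (u1 \<bullet> (A *v v2)) *\<^sub>R wedge u1 v2
    + (u2 \<bullet> (A *v v1)) *\<^sub>R wedge u2 v1 + (u2 \<bullet> (A *v v2)) *\<^sub>R wedge u2 v2
    + (u1 \<bullet> (A *v u2)) *\<^sub>R wedge u1 u2 + (v1 \<bullet> (A *v v2)) *\<^sub>R wedge v1 v2" (is "A = ?S")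
proof -
  define S where "S = ?S"
  note skew = so4_inner_skew[OF A]
  have eq: "(A *v w - S *v w) \<bullet> e = 0" if "e \<in> {u1, v1, u2, v2}" "w \<in> {u1, v1, u2, v2}" for e w
    using that so4_inner_self[OF A]
      skew[of v1 u1] skew[of v2 u1] skew[of v1 u2] skew[of v2 u2] skew[of u2 u1] skew[of v2 v1]
    unfolding S_def inner_commute[of _ e]
    by (auto simp: mvec.add_left mvec.scaleR_left wedge_mult_vec inner_add_right inner_diff_right
        orthonormal4_inner[OF on])
  have basis: "A *v w = S *v w" if "w \<in> {u1, v1, u2, v2}" for w
    using frame_expansion[OF on span, of "A *v w - S *v w"] eq[OF _ that] by simp
  have lin: "A *v (a *\<^sub>R u1 + b *\<^sub>R v1 + c *\<^sub>R u2 + d *\<^sub>R v2)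
      = S *v (a *\<^sub>R u1 + b *\<^sub>R v1 + c *\<^sub>R u2 + d *\<^sub>R v2)"
    for a b c d
    by (simp add: mvec.add_right mvec.scaleR_right basis)
  have "A *v z = S *v z" for z
    using lin[of "z \<bullet> u1" "z \<bullet> v1" "z \<bullet> u2" "z \<bullet> v2"]
    unfolding frame_expansion[OF on span, of z, symmetric] .
  then have "A = S" by (simp add: matrix_eq)
  then show ?thesis unfolding S_def .
qed

lemma linear_endpoint_coords: "linear (endpoint_coords u1 v1 u2 v2 r1 r2)"
  by (rule linearI) (auto simp: endpoint_coords_def algebra_simps)

lemma linear_covector_coords:
  assumes "orthonormal4 u1 v1 u2 v2"
  shows "linear (covector_coords u1 v1 u2 v2 r1 r2 \<phi>1 \<phi>2)"
  by (rule linearI) (auto simp: covector_coords_eq[OF assms] algebra_simps)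

lemma bij_betw_endpoint_coords:
  assumes on: "orthonormal4 u1 v1 u2 v2" and span: "span {u1, v1, u2, v2} = UNIV"
    and r: "r1 \<noteq> 0" "r2 \<noteq> 0"
  shows "bij_betw (endpoint_coords u1 v1 u2 v2 r1 r2) UNIV (UNIV \<times> so4)"
proof (rule bij_betw_imageI)
  let ?f = "endpoint_coords u1 v1 u2 v2 r1 r2"
  show "inj ?f"
    unfolding linear_injective_0[OF linear_endpoint_coords]
  proof (intro allI impI)
    fix p assume p: "?f p = 0"
    obtain x y where xy: "p = (x, y)" by (cases p)
    have "(r1 * x$1) *\<^sub>R u1 + (r1 * y$1) *\<^sub>R v1 + (r2 * x$2) *\<^sub>R u2 + (r2 * y$2) *\<^sub>R v2 = 0"
      using p by (simp add: xy endpoint_coords_def zero_prod_def)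
    note 1 = frame_vector_eq_0[OF on this]
    have "(r1\<^sup>2 * y$3) *\<^sub>R wedge u1 v1 + (r1 * r2 * y$4) *\<^sub>R wedge u1 v2
      + (- (r1 * r2 * y$5)) *\<^sub>R wedge u2 v1 + (r2\<^sup>2 * y$6) *\<^sub>R wedge u2 v2
      + (r1 * r2 * x$3) *\<^sub>R wedge u1 u2 + (r1 * r2 * x$4) *\<^sub>R wedge v1 v2 = 0"
      using p by (simp add: xy endpoint_coords_def zero_prod_def)
    note 2 = frame_bivector_eq_0[OF on this]
    show "p = 0"
      using 1 2 r by (simp add: xy zero_prod_def vec_eq_iff forall_4 forall_6)
  qed
  show "range ?f = UNIV \<times> so4"
  proof
    show "range ?f \<subseteq> UNIV \<times> so4"
      by (auto simp: endpoint_coords_def simp del: scaleR_minus_left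
          intro!: subspace_add subspace_scale subspace_so4)
    show "UNIV \<times> so4 \<subseteq> range ?f"
    proof
      fix p :: point assume "p \<in> UNIV \<times> so4"
      then obtain z A where p: "p = (z, A)" and A: "A \<in> so4" by auto
      let ?x = "vector [(z \<bullet> u1) / r1, (z \<bullet> u2) / r2,
          (u1 \<bullet> (A *v u2)) / (r1 * r2), (v1 \<bullet> (A *v v2)) / (r1 * r2)] :: real^4"
      let ?y = "vector [(z \<bullet> v1) / r1, (z \<bullet> v2) / r2, (u1 \<bullet> (A *v v1)) / r1\<^sup>2,
          (u1 \<bullet> (A *v v2)) / (r1 * r2), - (u2 \<bullet> (A *v v1)) / (r1 * r2), (u2 \<bullet> (A *v v2)) / r2\<^sup>2] :: real^6"
      have "?f (?x, ?y) = p"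
        using r frame_expansion[OF on span, of z] so4_frame_expansion[OF on span A]
        by (simp add: p endpoint_coords_def vector_4 vector_6)
      then show "p \<in> range ?f" by (metis rangeI)
    qed
  qed
qed

text \<open>The \<open>so(4)\<close> component determines the angular variations and four of the rotations. The latter
  enter through two systems with determinant \<open>\<plusminus>(\<phi>1\<^sup>2 - \<phi>2\<^sup>2)\<close>. The two rotations
  inside the planes leave \<open>\<tau>\<close> fixed, but together with the radii they move \<open>\<xi>\<close> freely
  in each plane.\<close>

lemma inj_covector_coords:
  assumes on: "orthonormal4 u1 v1 u2 v2"
    and r: "r1 \<noteq> 0" "r2 \<noteq> 0" and \<phi>: "\<phi>1\<^sup>2 \<noteq> \<phi>2\<^sup>2"
  shows "inj (covector_coords u1 v1 u2 v2 r1 r2 \<phi>1 \<phi>2)"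
  unfolding linear_injective_0[OF linear_covector_coords[OF on]]
proof (intro allI impI)
  have solve: "a = 0" "b = 0" if "\<phi>1 * a - \<phi>2 * b = 0" "\<phi>1 * b - \<phi>2 * a = 0" for a b
  proof -
    have "(\<phi>1\<^sup>2 - \<phi>2\<^sup>2) * a = \<phi>1 * (\<phi>1 * a - \<phi>2 * b) + \<phi>2 * (\<phi>1 * b - \<phi>2 * a)"
      "(\<phi>1\<^sup>2 - \<phi>2\<^sup>2) * b = \<phi>2 * (\<phi>1 * a - \<phi>2 * b) + \<phi>1 * (\<phi>1 * b - \<phi>2 * a)"
      by (simp_all add: algebra_simps power2_eq_square)
    then show "a = 0" "b = 0" using \<phi> that by auto
  qed
  have rot: "a = 0" "b = 0" if "a * sin t - cos t * b = 0" "a * cos t + sin t * b = 0" for a b t :: real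
  proof -
    have "a * ((sin t)\<^sup>2 + (cos t)\<^sup>2) = sin t * (a * sin t - cos t * b) + cos t * (a * cos t + sin t * b)"
      "b * ((sin t)\<^sup>2 + (cos t)\<^sup>2) = sin t * (a * cos t + sin t * b) - cos t * (a * sin t - cos t * b)"
      by (simp_all only: algebra_simps power2_eq_square)
    then show "a = 0" "b = 0" unfolding that by simp_all
  qed
  fix p assume p: "covector_coords u1 v1 u2 v2 r1 r2 \<phi>1 \<phi>2 p = 0"
  obtain x y where xy: "p = (x, y)" by (cases p)
  note eqs = p[unfolded xy covector_coords_eq[OF on] zero_prod_def prod.inject]
  note 2 = frame_bivector_eq_0[OF on conjunct2[OF eqs]]
  have y: "y$1 = 0" "y$2 = 0" "y$5 = 0" "y$6 = 0" and x: "x$3 = 0" "x$4 = 0"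
    using solve[of "y$1" "y$2"] solve[of "x$3" "x$4"] 2 r by auto
  note 1 = frame_vector_eq_0[OF on conjunct1[OF eqs]]
  have "y$3 * sin \<phi>1 - cos \<phi>1 * x$1 = 0" "y$3 * cos \<phi>1 + sin \<phi>1 * x$1 = 0"
    "y$4 * sin \<phi>2 - cos \<phi>2 * x$2 = 0" "y$4 * cos \<phi>2 + sin \<phi>2 * x$2 = 0"
    using 1 r by (simp_all add: x y)
  then have "y$3 = 0" "x$1 = 0" "y$4 = 0" "x$2 = 0"
    by (blast intro: rot)+
  with x y show "p = 0"
    by (simp add: xy zero_prod_def vec_eq_iff forall_4 forall_6)
qed

lemma linear_range_eqI:
  fixes f g :: "'a::euclidean_space \<Rightarrow> 'b::euclidean_space"
  assumes "linear f" "inj f" "linear g" "inj g" "range f \<subseteq> range g"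
  shows "range f = range g"
proof (rule subspace_dim_equal)
  show "subspace (range f)" "subspace (range g)"
    using assms by (auto intro: linear_subspace_image)
  have "dim (range f) = DIM('a)" "dim (range g) = DIM('a)"
    using dim_image_eq[of f UNIV] dim_image_eq[of g UNIV] assms by (simp_all add: inj_on_subset)
  then show "dim (range g) \<le> dim (range f)" by simp
qed fact

text \<open>Surjectivity by counting dimensions: the target coordinates show that
  \<open>\<real>\<^sup>4 \<times> so(4)\<close> has the dimension of the coordinate space.\<close>

lemma bij_betw_covector_coords:
  assumes on: "orthonormal4 u1 v1 u2 v2" and span: "span {u1, v1, u2, v2} = UNIV"
    and r: "r1 \<noteq> 0" "r2 \<noteq> 0" and \<phi>: "\<phi>1\<^sup>2 \<noteq> \<phi>2\<^sup>2"
  shows "bij_betw (covector_coords u1 v1 u2 v2 r1 r2 \<phi>1 \<phi>2) UNIV (UNIV \<times> so4)"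
proof (rule bij_betw_imageI)
  let ?f = "covector_coords u1 v1 u2 v2 r1 r2 \<phi>1 \<phi>2" and ?g = "endpoint_coords u1 v1 u2 v2 r1 r2"
  show inj: "inj ?f" by (rule inj_covector_coords[OF on r \<phi>])
  have g: "inj ?g" "range ?g = UNIV \<times> so4"
    using bij_betw_endpoint_coords[OF on span r] by (auto simp: bij_betw_def)
  have "range ?f \<subseteq> UNIV \<times> so4"
    by (auto simp: covector_coords_eq[OF on] intro!: subspace_add subspace_scale subspace_so4)
  then show "range ?f = UNIV \<times> so4"
    using linear_range_eqI[OF linear_covector_coords[OF on] inj linear_endpoint_coords g(1)] g(2) by simp
qed

lemma bij_block_diagonal_iff:
  fixes A :: "real^'n^'n" and B :: "real^'m^'m"
  shows "bij (\<lambda>(x, y). (A *v x, B *v y)) \<longleftrightarrow> invertible A \<and> invertible B"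
proof -
  have "inj (\<lambda>(x, y). (A *v x, B *v y)) \<longleftrightarrow> inj ((*v) A) \<and> inj ((*v) B)"
    unfolding inj_def by (auto simp: split_paired_all)
  moreover have "surj (\<lambda>(x, y). (A *v x, B *v y)) \<longleftrightarrow> surj ((*v) A) \<and> surj ((*v) B)"
    unfolding surj_def by (auto simp: split_paired_all)
  ultimately show ?thesis by (auto simp: invertible_eq_bij bij_def)
qed

text \<open>Both coordinate maps are bijective, and between them the differential acts as the block diagonal
  matrix with blocks \<open>M\<^sub>1\<close> and \<open>M\<^sub>2\<close>.\<close>

lemma derivative_bijective_iff:
  assumes D: "(sR_exp has_derivative D) (at (covector u1 v1 u2 v2 r1 r2 \<phi>1 \<phi>2) within UNIV \<times> so4)"
    and on: "orthonormal4 u1 v1 u2 v2" and span: "span {u1, v1, u2, v2} = UNIV"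
    and r: "r1 \<noteq> 0" "r2 \<noteq> 0" and \<phi>: "\<phi>1 \<noteq> 0" "\<phi>2 \<noteq> 0" "\<phi>1\<^sup>2 \<noteq> \<phi>2\<^sup>2"
  shows "bij_betw D (UNIV \<times> so4) (UNIV \<times> so4)
    \<longleftrightarrow> invertible (M1 r1 r2 \<phi>1 \<phi>2) \<and> invertible (M2 r1 r2 \<phi>1 \<phi>2)"
proof -
  let ?f = "covector_coords u1 v1 u2 v2 r1 r2 \<phi>1 \<phi>2" and ?g = "endpoint_coords u1 v1 u2 v2 r1 r2"
  let ?M = "\<lambda>(x, y). (M1 r1 r2 \<phi>1 \<phi>2 *v x, M2 r1 r2 \<phi>1 \<phi>2 *v y)"
  have f: "bij_betw ?f UNIV (UNIV \<times> so4)" by (rule bij_betw_covector_coords[OF on span r \<phi>(3)])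
  have g: "bij_betw ?g UNIV (UNIV \<times> so4)" by (rule bij_betw_endpoint_coords[OF on span r])
  have "D \<circ> ?f = ?g \<circ> ?M"
    by (auto simp: fun_eq_iff covector_coords_def endpoint_variation_coords[OF on]
        derivative_along_variation[OF D on generator_in_so4 \<phi>])
  then have "bij_betw D (UNIV \<times> so4) (UNIV \<times> so4) \<longleftrightarrow> bij_betw (?g \<circ> ?M) UNIV (UNIV \<times> so4)"
    using bij_betw_comp_iff[OF f, of D "UNIV \<times> so4"] by simp
  also have "\<dots> \<longleftrightarrow> bij ?M"
    using bij_betw_comp_iff2[OF g, of ?M UNIV] by simp
  finally show ?thesis by (simp add: bij_block_diagonal_iff)
qed

lemma sR_exp_singular_at_covector_iff:
  assumes on: "orthonormal4 u1 v1 u2 v2" and span: "span {u1, v1, u2, v2} = UNIV"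
    and r: "r1 \<noteq> 0" "r2 \<noteq> 0" and \<phi>: "\<phi>1 \<noteq> 0" "\<phi>2 \<noteq> 0" "\<phi>1\<^sup>2 \<noteq> \<phi>2\<^sup>2"
  shows "sR_exp_singular_at (covector u1 v1 u2 v2 r1 r2 \<phi>1 \<phi>2)
    \<longleftrightarrow> \<not> invertible (M1 r1 r2 \<phi>1 \<phi>2) \<or> \<not> invertible (M2 r1 r2 \<phi>1 \<phi>2)"
proof -
  let ?p = "covector u1 v1 u2 v2 r1 r2 \<phi>1 \<phi>2"
  have "\<exists>D. (sR_exp has_derivative D) (at ?p within UNIV \<times> so4)"
    using sR_exp_differentiable[of "snd ?p" "fst ?p"] by (simp add: snd_covector_in_so4)
  then show ?thesis
    unfolding sR_exp_singular_at_def
    using derivative_bijective_iff[OF _ on span r \<phi>] by blast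
qed

lemma orthonormal_basis_orthonormal4:
  assumes "orthonormal_basis [u1, v1, u2, v2]"
  shows "orthonormal4 u1 v1 u2 v2" "span {u1, v1, u2, v2} = UNIV"
  using assms
  by (auto simp: orthonormal_basis_def orthonormal4_def pairwise_insert orthogonal_def norm_eq_1)

theorem theorem1p2:
  fixes u1 v1 u2 v2 a1 b1 a2 b2 \<xi> :: "real^4"
    and \<tau> :: "real^4^4"
    and r1 r2 \<phi>1 \<phi>2 :: real
    and \<gamma> :: "real \<Rightarrow> point"
  assumes "orthonormal_basis [u1, v1, u2, v2]"
    and "r1 > 0" and "r2 > 0"
    and "\<phi>1 > \<phi>2" and "\<phi>2 > 0"
    and "a1 = r1 *\<^sub>R (sin \<phi>1 *\<^sub>R u1 + cos \<phi>1 *\<^sub>R v1)"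
    and "b1 = r1 *\<^sub>R (sin \<phi>1 *\<^sub>R v1 - cos \<phi>1 *\<^sub>R u1)"
    and "a2 = r2 *\<^sub>R (sin \<phi>2 *\<^sub>R u2 + cos \<phi>2 *\<^sub>R v2)"
    and "b2 = r2 *\<^sub>R (sin \<phi>2 *\<^sub>R v2 - cos \<phi>2 *\<^sub>R u2)"
    and "\<gamma> = extremal a1 b1 a2 b2 \<phi>1 \<phi>2"
    and "\<xi> = a1 + a2"
    and "\<tau> = (2 * \<phi>1 / r1\<^sup>2) *\<^sub>R wedge a1 b1 + (2 * \<phi>2 / r2\<^sup>2) *\<^sub>R wedge a2 b2"
  shows "extremal_control a1 b1 a2 b2 \<phi>1 \<phi>2 = covector_control \<xi> \<tau> \<and>
    \<gamma> 1 = ((r1 * T \<phi>1) *\<^sub>R v1 + (r2 * T \<phi>2) *\<^sub>R v2,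
           (r1\<^sup>2 * U \<phi>1) *\<^sub>R wedge u1 v1
         + (r1 * r2 * Z \<phi>1 \<phi>2) *\<^sub>R wedge u1 v2
         + (r1 * r2 * Z \<phi>2 \<phi>1) *\<^sub>R wedge u2 v1
         + (r2\<^sup>2 * U \<phi>2) *\<^sub>R wedge u2 v2) \<and>
    (conjugate_along (\<xi>, \<tau>) \<gamma> (\<gamma> 1) \<longleftrightarrow>
       \<not> invertible (M1 r1 r2 \<phi>1 \<phi>2) \<or> \<not> invertible (M2 r1 r2 \<phi>1 \<phi>2))"
proof -
  note on = orthonormal_basis_orthonormal4[OF assms(1)]
  have r: "r1 \<noteq> 0" "r2 \<noteq> 0" using assms by auto
  have "\<phi>2\<^sup>2 < \<phi>1\<^sup>2" using assms by (intro power_strict_mono) auto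
  then have \<phi>: "\<phi>1 \<noteq> 0" "\<phi>2 \<noteq> 0" "\<phi>1\<^sup>2 \<noteq> \<phi>2\<^sup>2" using assms by auto
  have plane: "(2 * \<phi> / r\<^sup>2) *\<^sub>R wedge (r *\<^sub>R (sin \<phi> *\<^sub>R u + cos \<phi> *\<^sub>R v)) (r *\<^sub>R (sin \<phi> *\<^sub>R v - cos \<phi> *\<^sub>R u))
      = (2 * \<phi>) *\<^sub>R wedge u v" if "r \<noteq> 0" for r \<phi> u v
  proof -
    have "wedge (r *\<^sub>R (sin \<phi> *\<^sub>R u + cos \<phi> *\<^sub>R v)) (r *\<^sub>R (sin \<phi> *\<^sub>R v - cos \<phi> *\<^sub>R u))
        = (r\<^sup>2 * ((sin \<phi>)\<^sup>2 + (cos \<phi>)\<^sup>2)) *\<^sub>R wedge u v"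
      by (simp only: wedge.scaleR_left wedge.scaleR_right wedge.add_left wedge.diff_right
          wedge_self wedge_antisym[of v u])
         (simp add: power2_eq_square algebra_simps 
            del: sin_cos_squared_add sin_cos_squared_add2 sin_cos_squared_add3)
    then show ?thesis using that by simp
  qed
  have cov: "(\<xi>, \<tau>) = covector u1 v1 u2 v2 r1 r2 \<phi>1 \<phi>2"
    unfolding assms(6-9,11,12) plane[OF r(1)] plane[OF r(2)] covector_def
    by (simp add: scaleR_add_right)
  have \<tau>: "\<tau> \<in> so4" using snd_covector_in_so4[of u1 v1 u2 v2 r1 r2 \<phi>1 \<phi>2] by (simp add: cov[symmetric])
  \<comment> \<open>The addition theorems turn the expansion in \<open>a, b\<close> into one in the frame.\<close>
  have "extremal_control a1 b1 a2 b2 \<phi>1 \<phi>2 = frame_control u1 v1 u2 v2 r1 r2 \<phi>1 \<phi>2"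
  proof
    fix s :: real
    have "\<phi> * (1 - 2 * s) = \<phi> - 2 * \<phi> * s" for \<phi> by (simp add: algebra_simps)
    then show "extremal_control a1 b1 a2 b2 \<phi>1 \<phi>2 s = frame_control u1 v1 u2 v2 r1 r2 \<phi>1 \<phi>2 s"
      unfolding extremal_control_def frame_control_def assms(6-9)
      by (simp add: sin_diff cos_diff algebra_simps)
  qed
  then have control: "extremal_control a1 b1 a2 b2 \<phi>1 \<phi>2 = covector_control \<xi> \<tau>"
    and \<gamma>: "\<gamma> = curve (frame_control u1 v1 u2 v2 r1 r2 \<phi>1 \<phi>2)"
    unfolding covector_control_frame[OF on(1) cov] assms(10) extremal_def by simp_all
  have "conjugate_along (\<xi>, \<tau>) \<gamma> (\<gamma> 1) \<longleftrightarrow> sR_exp_singular_at (\<xi>, \<tau>)"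
    unfolding conjugate_along_def using \<tau> control assms(10) by (simp add: extremal_def)
  then show ?thesis
    unfolding cov sR_exp_singular_at_covector_iff[OF on r \<phi>]
    using control curve_frame_control[OF \<phi>] by (simp add: \<gamma> endpoint_def)
qed

end
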